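(* For each $n\in\mathbb{N}$ and each $r\in(0,+\infty]$, the homomorphism of Fréchet $\mathcal{O}(\mathbb{C}^\times)$-algebras $i_{\mathbb{D}\mathbb{D}}\colon\mathcal{O}_{\mathrm{def}}(\mathbb{D}^n_r)\to\mathcal{O}^{\mathrm T}_{\mathrm{def}}(\mathbb{D}^n_r)$ induced by the continuous inclusion $\mathcal{F}(\mathbb{D}^n_r)\subset\mathcal{F}^{\mathrm T}(\mathbb{D}^n_r)$ is a topological isomorphism.
   Context: All algebras are complex, associative and unital; a Fréchet algebra is a complete metrizable locally convex algebra. $\mathbb{C}^\times=\mathbb{C}\setminus\{0\}$. $W_{n,d}=\{1,\dots,n\}^d$, $W_n=\bigsqcup_{d\ge0}W_{n,d}$, $|\alpha|=d$ for $\alpha\in W_{n,d}$, $\zeta_\alpha=\zeta_{\alpha_1}\cdots\zeta_{\alpha_d}$ ($=1$ if $d=0$). $\mathfrak{F}_n$ is the algebra of formal series $\sum_{\alpha\in W_n} c_\alpha\zeta_\alpha$ in free variables $\zeta_1,\dots,\zeta_n$. $\mathrm{s}(\alpha)=\mathrm{card}\{i\in\{1,\dots,d-1\}:\alpha_i\ne\alpha_{i+1}\}$ if $d=|\alpha|\ge2$, and $\mathrm{s}(\alpha)=|\alpha|-1$ if $|\alpha|\le1$. The following are Fréchet algebras with multiplication from $\mathfrak{F}_n$ and topology given by the indicated norms: - $\mathcal{F}(\mathbb{D}^n_r)$: all $a=\sum_\alpha c_\alpha\zeta_\alpha$ with $\|a\|_{\rho,\tau}=\sum_\alpha|c_\alpha|\rho^{|\alpha|}\tau^{\mathrm{s}(\alpha)+1}<\infty$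 for all $\rho\in(0,r)$, $\tau\ge1$ (this is a concrete form of the Arens-Michael free product of $n$ copies of the algebra of holomorphic functions on the disk of radius $r$); - $\mathcal{F}^{\mathrm T}(\mathbb{D}^n_r)$: all $a$ with $\|a\|_\rho=\sum_\alpha|c_\alpha|\rho^{|\alpha|}<\infty$ for all $\rho\in(0,r)$. One has $\mathcal{F}(\mathbb{D}^n_r)\subset\mathcal{F}^{\mathrm T}(\mathbb{D}^n_r)$ continuously. For a Fréchet algebra $F$, $\mathcal{O}(\mathbb{C}^\times,F)$ is the Fréchet algebra of holomorphic $F$-valued functions on $\mathbb{C}^\times$ (compact-open topology), canonically an algebra over $\mathcal{O}(\mathbb{C}^\times)$; elements of $F$ are regarded as constant functions and $z\in\mathcal{O}(\mathbb{C}^\times)$ is the coordinate. Let $I_{\mathbb{D}}\subset\mathcal{O}(\mathbb{C}^\times,\mathcal{F}(\mathbb{D}^n_r))$ and $I^{\mathrm T}_{\mathbb{D}}\subset\mathcal{O}(\mathbb{C}^\times,\mathcal{F}^{\mathrm T}(\mathbb{D}^n_r))$ be the closed two-sided ideals generated by the elements $\zeta_i\zeta_j-z\zeta_j\zeta_i$ ($i<j$). Put $\mathcal{O}_{\mathrm{def}}(\mathbb{D}^n_r)=\mathcal{O}(\mathbb{C}^\times,\mathcal{F}(\mathbb{D}^n_r))/I_{\mathbb{D}}$ and $\mathcal{O}^{\mathrm T}_{\mathrm{def}}(\mathbb{D}^n_r)=\mathcal{O}(\mathbb{C}^\times,\mathcal{F}^{\mathrm T}(\mathbb{D}^n_r))/I^{\mathrm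 T}_{\mathbb{D}}$, with quotient topologies. The map $i_{\mathbb{D}\mathbb{D}}$ sends $f+I_{\mathbb{D}}$ to $f+I^{\mathrm T}_{\mathbb{D}}$ (well defined). *)

theory Defs
  imports "HOL-Analysis.Analysis" "HOL-Algebra.QuotRing" "HOL-Algebra.Module"
begin

section \<open>Topological algebras, closed ideals and quotients\<close>

text \<open>
  An algebra carrying a topology on its carrier. As in \<^theory>\<open>HOL-Algebra.Module\<close>, the scalars
  (type \<open>'k\<close>) are not part of the record.
\<close>

record ('k, 'a) topalg = "('k, 'a) module" +
  topo :: "'a topology"

definition closed_ideal_gen :: "('k, 'a, 'm) topalg_scheme \<Rightarrow> 'a set \<Rightarrow> 'a set" where
  "closed_ideal_gen A S = \<Inter>{I. ideal I A \<and> closedin (topo A) I \<and> S \<subseteq> I}"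

definition quot_topology :: "'a topology \<Rightarrow> ('a \<Rightarrow> 'b) \<Rightarrow> 'b topology" where
  "quot_topology X q =
     topology (\<lambda>U. U \<subseteq> q ` topspace X \<and> openin X {x \<in> topspace X. q x \<in> U})"

lemma openin_quot_topology:
  "openin (quot_topology X q) U \<longleftrightarrow> U \<subseteq> q ` topspace X \<and> openin X {x \<in> topspace X. q x \<in> U}"
proof -
  have "istopology (\<lambda>U. U \<subseteq> q ` topspace X \<and> openin X {x \<in> topspace X. q x \<in> U})"
    unfolding istopology_def
  proof (intro conjI allI impI; (elim conjE)?)
    fix S T
    assume "openin X {x \<in> topspace X. q x \<in> S}" "openin X {x \<in> topspace X. q x \<in> T}"
    then have "openin X ({x \<in> topspace X. q x \<in> S} \<inter> {x \<in> topspace X. q x \<in> T})" by blast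
    also have "{x \<in> topspace X. q x \<in> S} \<inter> {x \<in> topspace X. q x \<in> T}
             = {x \<in> topspace X. q x \<in> S \<inter> T}" by blast
    finally show "openin X {x \<in> topspace X. q x \<in> S \<inter> T}" .
  next
    fix \<K> assume "\<forall>K\<in>\<K>. K \<subseteq> q ` topspace X \<and> openin X {x \<in> topspace X. q x \<in> K}"
    then have "openin X (\<Union>K\<in>\<K>. {x \<in> topspace X. q x \<in> K})" by blast
    also have "(\<Union>K\<in>\<K>. {x \<in> topspace X. q x \<in> K}) = {x \<in> topspace X. q x \<in> \<Union>\<K>}" by blast
    finally show "openin X {x \<in> topspace X. q x \<in> \<Union>\<K>}" .
  qed auto
  then show ?thesis by (simp add: quot_topology_def topology_inverse')
qed

lemma quotient_map_quot_topology: "quotient_map X (quot_topology X q) q"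
proof -
  have *: "{x \<in> topspace X. q x \<in> q ` topspace X} = topspace X" by blast
  have "openin (quot_topology X q) (q ` topspace X)"
    unfolding openin_quot_topology * by simp
  then have "topspace (quot_topology X q) = q ` topspace X"
    by (metis openin_quot_topology openin_subset openin_topspace subset_antisym)
  then show ?thesis by (simp add: quotient_map_def openin_quot_topology)
qed

definition quot_alg :: "('k, 'a, 'm) topalg_scheme \<Rightarrow> 'a set \<Rightarrow> ('k, 'a set) topalg" where
  "quot_alg A I =
     \<lparr>carrier = carrier (A Quot I), mult = mult (A Quot I), one = one (A Quot I),
      zero = zero (A Quot I), add = add (A Quot I),
      smult = (\<lambda>k X. \<Union>x\<in>X. I +>\<^bsub>A\<^esub> (k \<odot>\<^bsub>A\<^esub> x)),
      topo = quot_topology (topo A) (\<lambda>x. I +>\<^bsub>A\<^esub> x)\<rparr>"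

definition alg_hom ::
  "'k set \<Rightarrow> ('k, 'a, 'm) topalg_scheme \<Rightarrow> ('k, 'b, 'n) topalg_scheme \<Rightarrow> ('a \<Rightarrow> 'b) set" where
  "alg_hom K A B = {h \<in> ring_hom A B.
     \<forall>k\<in>K. \<forall>x\<in>carrier A. h (k \<odot>\<^bsub>A\<^esub> x) = k \<odot>\<^bsub>B\<^esub> h x}"

definition top_alg_iso ::
  "'k set \<Rightarrow> ('k, 'a, 'm) topalg_scheme \<Rightarrow> ('k, 'b, 'n) topalg_scheme \<Rightarrow> ('a \<Rightarrow> 'b) set" where
  "top_alg_iso K A B = {h \<in> alg_hom K A B.
     bij_betw h (carrier A) (carrier B) \<and> homeomorphic_map (topo A) (topo B) h}"


section \<open>Algebras of free power series\<close>

text \<open>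
  The words \<open>W\<^sub>n\<close>. A formal series in the free variables \<open>\<zeta>\<^sub>1, \<dots>, \<zeta>\<^sub>n\<close> is the
  function assigning to each word its coefficient; it vanishes off \<open>W\<^sub>n\<close>.
\<close>

definition words :: "nat \<Rightarrow> nat list set" where
  "words n = {\<alpha>. set \<alpha> \<subseteq> {1..n}}"

definition sw :: "nat list \<Rightarrow> int" where
  "sw \<alpha> = (if length \<alpha> \<ge> 2 then int (card {i. i + 1 < length \<alpha> \<and> \<alpha> ! i \<noteq> \<alpha> ! (i + 1)})
           else int (length \<alpha>) - 1)"

type_synonym series = "nat list \<Rightarrow> complex"

definition formal_series :: "nat \<Rightarrow> series set" where
  "formal_series n = {a. \<forall>\<alpha>. \<alpha> \<notin> words n \<longrightarrow> a \<alpha> = 0}"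

definition monomial :: "nat list \<Rightarrow> series" where
  "monomial \<alpha> = (\<lambda>\<beta>. if \<beta> = \<alpha> then 1 else 0)"

definition series_mult :: "series \<Rightarrow> series \<Rightarrow> series" where
  "series_mult a b = (\<lambda>\<gamma>. \<Sum>k\<le>length \<gamma>. a (take k \<gamma>) * b (drop k \<gamma>))"

definition wnorm :: "nat \<Rightarrow> (nat list \<Rightarrow> real) \<Rightarrow> series \<Rightarrow> real" where
  "wnorm n w a = (\<Sum>\<^sub>\<infinity>\<alpha>\<in>words n. cmod (a \<alpha>) * w \<alpha>)"

definition weighted_carrier :: "nat \<Rightarrow> (nat list \<Rightarrow> real) set \<Rightarrow> series set" where
  "weighted_carrier n \<W> =
     {a \<in> formal_series n. \<forall>w\<in>\<W>. (\<lambda>\<alpha>. cmod (a \<alpha>) * w \<alpha>) summable_on words n}"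

text \<open>
  The series for which all the norms \<open>\<Sum>\<^sub>\<alpha> |c\<^sub>\<alpha>| w(\<alpha>)\<close>, \<open>w \<in> \<W>\<close>, are finite, with the
  topology given by these norms.
\<close>

definition weighted_alg ::
  "nat \<Rightarrow> (nat list \<Rightarrow> real) set \<Rightarrow> (complex, series) topalg" where
  "weighted_alg n \<W> =
     \<lparr>carrier = weighted_carrier n \<W>, mult = series_mult, one = monomial [],
      zero = (\<lambda>\<alpha>. 0), add = (\<lambda>a b \<alpha>. a \<alpha> + b \<alpha>), smult = (\<lambda>c a \<alpha>. c * a \<alpha>),
      topo = topology_generated_by
        {{b \<in> weighted_carrier n \<W>. wnorm n w (\<lambda>\<alpha>. b \<alpha> - a \<alpha>) < e} | w a e.
           w \<in> \<W> \<and> a \<in> weighted_carrier n \<W> \<and> e > 0}\<rparr>"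

definition F_disk :: "nat \<Rightarrow> ereal \<Rightarrow> (complex, series) topalg" where
  "F_disk n r = weighted_alg n
     {(\<lambda>\<alpha>. \<rho> ^ length \<alpha> * \<tau> powi (sw \<alpha> + 1)) | \<rho> \<tau>. 0 < \<rho> \<and> ereal \<rho> < r \<and> 1 \<le> \<tau>}"

definition FT_disk :: "nat \<Rightarrow> ereal \<Rightarrow> (complex, series) topalg" where
  "FT_disk n r = weighted_alg n {(\<lambda>\<alpha>. \<rho> ^ length \<alpha>) | \<rho>. 0 < \<rho> \<and> ereal \<rho> < r}"


section \<open>Holomorphic functions on the punctured plane with values in a topological algebra\<close>

text \<open>
  Functions on \<open>\<complex>\<^sup>\<times>\<close> are represented by functions on the complex plane that take the value
  \<^const>\<open>undefined\<close> at \<open>0\<close>. Holomorphic means complex differentiable at every point of \<open>\<complex>\<^sup>\<times>\<close>, with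
  the limit of the difference quotient taken in the topology of \<open>F\<close>; the topology is the
  compact-open one.
\<close>

definition Cx :: "complex set" where
  "Cx = - {0}"

definition hol_Cx :: "(complex \<Rightarrow> complex) set" where
  "hol_Cx = {g \<in> extensional Cx. g holomorphic_on Cx}"

definition hol_carrier :: "(complex, 'a) topalg \<Rightarrow> (complex \<Rightarrow> 'a) set" where
  "hol_carrier F = {f \<in> Cx \<rightarrow>\<^sub>E carrier F.
     \<forall>z\<in>Cx. \<exists>l. limitin (topo F)
       (\<lambda>w. inverse (w - z) \<odot>\<^bsub>F\<^esub> (f w \<ominus>\<^bsub>F\<^esub> f z)) l (at z)}"

definition hol_alg ::
  "(complex, 'a) topalg \<Rightarrow> (complex \<Rightarrow> complex, complex \<Rightarrow> 'a) topalg" where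
  "hol_alg F =
     \<lparr>carrier = hol_carrier F,
      mult = (\<lambda>f g. \<lambda>z\<in>Cx. f z \<otimes>\<^bsub>F\<^esub> g z), one = (\<lambda>z\<in>Cx. \<one>\<^bsub>F\<^esub>),
      zero = (\<lambda>z\<in>Cx. \<zero>\<^bsub>F\<^esub>), add = (\<lambda>f g. \<lambda>z\<in>Cx. f z \<oplus>\<^bsub>F\<^esub> g z),
      smult = (\<lambda>h f. \<lambda>z\<in>Cx. h z \<odot>\<^bsub>F\<^esub> f z),
      topo = topology_generated_by
        {{f \<in> hol_carrier F. f ` K \<subseteq> U} | K U. compact K \<and> K \<subseteq> Cx \<and> openin (topo F) U}\<rparr>"

definition coord :: "complex \<Rightarrow> complex" where
  "coord = (\<lambda>z\<in>Cx. z)"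


section \<open>The deformation algebras and the map between them\<close>

definition zeta :: "nat \<Rightarrow> complex \<Rightarrow> series" where
  "zeta i = (\<lambda>z\<in>Cx. monomial [i])"

definition def_ideal ::
  "nat \<Rightarrow> (complex \<Rightarrow> complex, complex \<Rightarrow> series) topalg \<Rightarrow> (complex \<Rightarrow> series) set" where
  "def_ideal n A = closed_ideal_gen A
     {(zeta i \<otimes>\<^bsub>A\<^esub> zeta j) \<ominus>\<^bsub>A\<^esub> (coord \<odot>\<^bsub>A\<^esub> (zeta j \<otimes>\<^bsub>A\<^esub> zeta i)) | i j.
        1 \<le> i \<and> i < j \<and> j \<le> n}"

definition I_D :: "nat \<Rightarrow> ereal \<Rightarrow> (complex \<Rightarrow> series) set" where
  "I_D n r = def_ideal n (hol_alg (F_disk n r))"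

definition IT_D :: "nat \<Rightarrow> ereal \<Rightarrow> (complex \<Rightarrow> series) set" where
  "IT_D n r = def_ideal n (hol_alg (FT_disk n r))"

definition O_def ::
  "nat \<Rightarrow> ereal \<Rightarrow> (complex \<Rightarrow> complex, (complex \<Rightarrow> series) set) topalg" where
  "O_def n r = quot_alg (hol_alg (F_disk n r)) (I_D n r)"

definition OT_def ::
  "nat \<Rightarrow> ereal \<Rightarrow> (complex \<Rightarrow> complex, (complex \<Rightarrow> series) set) topalg" where
  "OT_def n r = quot_alg (hol_alg (FT_disk n r)) (IT_D n r)"

text \<open>
  On the coset of \<open>f\<close> this is the union of the cosets \<open>f' + I\<^sup>T\<close> over all representatives \<open>f'\<close>,
  which is the single coset \<open>f + I\<^sup>T\<close> exactly when the map \<open>f + I \<mapsto> f + I\<^sup>T\<close> is well defined at \<open>f\<close>.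
\<close>

definition i_DD :: "nat \<Rightarrow> ereal \<Rightarrow> (complex \<Rightarrow> series) set \<Rightarrow> (complex \<Rightarrow> series) set" where
  "i_DD n r X = (\<Union>f\<in>X. IT_D n r +>\<^bsub>hol_alg (FT_disk n r)\<^esub> f)"

end

theory Submission
  imports Defs
begin

text \<open>
  Modulo the relators, swapping two distinct neighbouring letters of a word costs a factor \<open>z\<close> or
  \<open>z\<inverse>\<close>, so words with the same letters and the same number of inversions become equal. Every
  word \<open>\<alpha>\<close> has a normal form with the same letters, the same number of inversions and at most
  \<open>4 * n\<close> blocks of equal letters. Since no power of \<open>z\<close> is involved, replacing each word by its
  normal form is a constant linear map \<open>\<Phi>\<close>; as \<open>\<tau>\<close> enters the norms only through the number of
  blocks, \<open>\<Phi>\<close> is continuous from the larger algebra \<open>\<F>\<^sup>T\<close> to the smaller algebra \<open>\<F>\<close>.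
  It is the identity and multiplicative modulo the closed ideals (first for polynomials, then by
  density), so it induces the continuous inverse.
\<close>

section \<open>Normal forms of words\<close>

text \<open>Fully sorted words cannot serve as normal forms. Modulo the ideal a word alpha is z to
  the power minus \<open>inversions alpha\<close> times its sorted word, and the number of
  inversions of a word of length d can be of order d^2. For |z| < 1 such factors outgrow every
  rho^d, so sorting is not continuous. The normal form therefore stores the exponent in the word, by
  keeping the inversions, and only limits the number of blocks, by a constant that does not depend
  on d. The map obtained in this way is no homomorphism. To see that it carries the larger ideal
  into the smaller one, one considers all f whose image lies in the smaller ideal: multiplicativity
  modulo that ideal makes them a closed ideal, and it contains the relators.\<close>

fun inversions :: "nat list \<Rightarrow> nat" where
  "inversions [] = 0"
| "inversions (x # xs) = length (filter (\<lambda>y. y < x) xs) + inversions xs"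

lemma inversions_append:
  "inversions (xs @ ys) =
     inversions xs + inversions ys + (\<Sum>x\<leftarrow>xs. length (filter (\<lambda>y. y < x) ys))"
  by (induction xs) auto

section \<open>Counting blocks of equal letters\<close>

lemma length_remdups_adj_Cons_le:
  "length (remdups_adj xs) \<le> length (remdups_adj (x # xs))"
  "length (remdups_adj (x # xs)) \<le> Suc (length (remdups_adj xs))"
  by (auto simp: remdups_adj_Cons split: list.split)

lemma length_remdups_adj_append_le:
  "length (remdups_adj (xs @ ys)) \<le> length (remdups_adj xs) + length (remdups_adj ys)"
proof (induction xs rule: remdups_adj.induct)
  case (2 x)
  then show ?case using length_remdups_adj_Cons_le(2)[of x ys] by simp
qed auto

text \<open>A cut splits at most the one block into which it falls.\<close>

lemma length_remdups_adj_split_le: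
  "length (remdups_adj xs) + length (remdups_adj ys) \<le> Suc (length (remdups_adj (xs @ ys)))"
proof (induction xs rule: remdups_adj.induct)
  case (2 x)
  then show ?case using length_remdups_adj_Cons_le(1)[of ys x] by simp
qed auto

lemma length_remdups_adj_replicate_le: "length (remdups_adj (replicate k x)) \<le> 1"
  by (auto simp: remdups_adj_replicate)

lemma card_switches:
  "xs \<noteq> [] \<Longrightarrow>
    Suc (card {i. i + 1 < length xs \<and> xs ! i \<noteq> xs ! (i + 1)}) = length (remdups_adj xs)"
proof (induction xs rule: remdups_adj.induct)
  case (3 x y zs)
  let ?S = "{i. i + 1 < length (y # zs) \<and> (y # zs) ! i \<noteq> (y # zs) ! (i + 1)}"
  let ?T = "{i. i + 1 < length (x # y # zs) \<and> (x # y # zs) ! i \<noteq> (x # y # zs) ! (i + 1)}"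
  \<comment> \<open>A switch of \<open>x # y # zs\<close> is position 0 or a switch of
    \<open>y # zs\<close> moved by one.\<close>
  have T: "?T = (if x = y then {} else {0}) \<union> Suc ` ?S"
  proof (rule Set.set_eqI)
    fix i show "i \<in> ?T \<longleftrightarrow> i \<in> (if x = y then {} else {0}) \<union> Suc ` ?S"
      by (cases i) auto
  qed
  have fin: "finite ?S" by simp
  have cS: "card (Suc ` ?S) = card ?S" by (simp add: card_image)
  have "0 \<notin> Suc ` ?S" by blast
  then have "card ?T = (if x = y then 0 else 1) + card ?S"
    unfolding T using fin cS by (cases "x = y") (simp_all add: card_insert_if)
  then show ?case using 3 by (cases "x = y") auto
qed auto

text \<open>The value -1 of \<open>sw\<close> at the empty word makes this hold there too. So the
  \<open>powi\<close> in the norms is an ordinary power whose exponent is the number of blocks, and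
  this number is subadditive under concatenation.\<close>

lemma sw_eq: "sw \<alpha> + 1 = int (length (remdups_adj \<alpha>))"
proof -
  consider "\<alpha> = []" | x where "\<alpha> = [x]" | "length \<alpha> \<ge> 2"
    by (cases \<alpha>; cases "tl \<alpha>") auto
  then show ?thesis
  proof cases
    case 3
    then have "\<alpha> \<noteq> []" by auto
    then show ?thesis using card_switches[of \<alpha>] 3 by (simp add: sw_def)
  qed (auto simp: sw_def)
qed

lemma words_append [simp]: "\<alpha> @ \<beta> \<in> words n \<longleftrightarrow> \<alpha> \<in> words n \<and> \<beta> \<in> words n"
  by (auto simp: words_def)

lemma words_Nil [simp]: "[] \<in> words n"
  by (simp add: words_def)

lemma finite_words_length: "finite {\<alpha> \<in> words n. length \<alpha> \<le> N}"
  using finite_lists_length_le[of "{1..n}" N] by (simp add: words_def conj_commute)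

lemma words_cong_mset: "mset \<alpha> = mset \<beta> \<Longrightarrow> \<alpha> \<in> words n \<longleftrightarrow> \<beta> \<in> words n"
  unfolding words_def by (metis mem_Collect_eq mset_eq_setD)

text \<open>P counts the pairs of an occurrence of the largest letter and a smaller letter behind
  it. It is bounded by the number of all pairs of such letters, and deleting the largest letter
  keeps every other inversion.\<close>

lemma inversions_split_last:
  assumes "\<alpha> \<in> words (Suc n)"
  shows "\<exists>P \<le> count_list \<alpha> (Suc n) * length (filter (\<lambda>x. x \<le> n) \<alpha>).
           inversions \<alpha> = inversions (filter (\<lambda>x. x \<le> n) \<alpha>) + P"
  using assms
proof (induction \<alpha>)
  case (Cons x xs)
  have xs: "xs \<in> words (Suc n)" and x: "x \<le> Suc n" "set xs \<subseteq> {1..Suc n}"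
    using Cons.prems by (auto simp: words_def)
  obtain P where P: "P \<le> count_list xs (Suc n) * length (filter (\<lambda>x. x \<le> n) xs)"
    "inversions xs = inversions (filter (\<lambda>x. x \<le> n) xs) + P"
    using Cons.IH[OF xs] by blast
  show ?case
  proof (cases "x = Suc n")
    case True
    have "filter (\<lambda>y. y < Suc n) xs = filter (\<lambda>x. x \<le> n) xs"
      by (auto intro: filter_cong)
    then show ?thesis
      using P True by (intro exI[of _ "P + length (filter (\<lambda>x. x \<le> n) xs)"]) auto
  next
    case False
    then have "filter (\<lambda>y. y < x) xs = filter (\<lambda>y. y < x) (filter (\<lambda>x. x \<le> n) xs)"
      using x by (auto intro!: filter_cong)
    moreover have "P \<le> count_list xs (Suc n) * Suc (length (filter (\<lambda>x. x \<le> n) xs))"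
      using P(1) by (meson le_SucI le_trans mult_le_mono2 order_refl)
    ultimately show ?thesis
      using P x False by (intro exI[of _ P]) auto
  qed
qed (simp add: words_def)

lemma sum_list_eq_const: "(\<And>x. x \<in> set xs \<Longrightarrow> f x = c) \<Longrightarrow> (\<Sum>x\<leftarrow>xs. f x) = length xs * (c::nat)"
  by (induction xs) auto

lemma mset_split_last:
  assumes "\<alpha> \<in> words (Suc n)"
  shows "mset \<alpha> = mset (filter (\<lambda>x. x \<le> n) \<alpha>) + replicate_mset (count_list \<alpha> (Suc n)) (Suc n)"
  using assms
proof (induction \<alpha>)
  case (Cons x xs)
  then have "xs \<in> words (Suc n)" and x: "x \<le> Suc n" by (auto simp: words_def)
  then show ?case using Cons.IH by (cases "x = Suc n") auto
qed simp

lemma inversions_replicate: "inversions (replicate k x) = 0"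
  by (induction k) auto

text \<open>
  If \<open>\<beta>\<close> has no letter \<open>Suc n\<close> and \<open>length \<beta> = L\<close>, then \<open>q\<close> copies of \<open>Suc n\<close> in front, one copy
  with \<open>t < L\<close> letters of \<open>\<beta>\<close> behind it and the remaining copies at the end create \<open>q * L + t\<close>
  new inversions and at most four new blocks.
\<close>

lemma normal_form_exists:
  "\<alpha> \<in> words n \<Longrightarrow> \<exists>\<beta>. mset \<beta> = mset \<alpha> \<and> inversions \<beta> = inversions \<alpha> \<and>
     length (remdups_adj \<beta>) \<le> 4 * n"
proof (induction n arbitrary: \<alpha>)
  case 0
  then show ?case by (auto simp: words_def intro: exI[of _ "[]"])
next
  case (Suc n)
  define \<alpha>' where "\<alpha>' = filter (\<lambda>x. x \<le> n) \<alpha>"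
  define m where "m = count_list \<alpha> (Suc n)"
  define L where "L = length \<alpha>'"
  have "\<alpha>' \<in> words n" using Suc.prems by (auto simp: words_def \<alpha>'_def)
  then obtain \<beta> where \<beta>: "mset \<beta> = mset \<alpha>'" "inversions \<beta> = inversions \<alpha>'"
      "length (remdups_adj \<beta>) \<le> 4 * n"
    using Suc.IH by blast
  have L: "length \<beta> = L" using \<beta>(1) by (metis L_def size_mset)
  have \<beta>n: "x \<le> n" if "x \<in> set \<beta>" for x
    using that mset_eq_setD[OF \<beta>(1)] by (auto simp: \<alpha>'_def)
  obtain P where P: "P \<le> m * L" "inversions \<alpha> = inversions \<alpha>' + P"
    using inversions_split_last[OF Suc.prems] unfolding \<alpha>'_def m_def L_def by blast
  have \<alpha>: "mset \<alpha> = mset \<alpha>' + replicate_mset m (Suc n)"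
    using mset_split_last[OF Suc.prems] by (simp add: \<alpha>'_def m_def)
  have flt: "filter (\<lambda>y. y < Suc n) ys = ys" if "set ys \<subseteq> set \<beta>" for ys
    using that \<beta>n by (metis filter_True le_imp_less_Suc subsetD)
  have flt0: "filter (\<lambda>y. y < x) (replicate k (Suc n)) = []" if "x \<le> Suc n" for x k
    using that by auto
  show ?case
  proof (cases "P = m * L")
    \<comment> \<open>Separate, because for positive \<open>L\<close> the quotient
      \<open>P div L\<close> would be \<open>m\<close> and leave no copy for the middle. An empty
      \<open>\<beta>\<close> lands here too, so \<open>L\<close> is positive in the other
      case.\<close>
    case True
    let ?\<gamma> = "replicate m (Suc n) @ \<beta>"
    have "(\<Sum>x\<leftarrow>replicate m (Suc n). length (filter (\<lambda>y. y < x) \<beta>)) = m * L"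
      using flt[of \<beta>] L by (subst sum_list_eq_const[where c = L]) auto
    then have "inversions ?\<gamma> = inversions \<alpha>"
      using \<beta> P True by (simp add: inversions_append inversions_replicate)
    moreover have "mset ?\<gamma> = mset \<alpha>" using \<alpha> \<beta> by simp
    moreover have "length (remdups_adj ?\<gamma>) \<le> 4 * Suc n"
      using order_trans[OF length_remdups_adj_append_le
          add_mono[OF length_remdups_adj_replicate_le[of m "Suc n"] \<beta>(3)]] by simp
    ultimately show ?thesis by blast
  next
    case False
    then have lt: "P < m * L" using P by simp
    then have Lpos: "L > 0" by (cases L) auto
    define q where "q = P div L"
    define t where "t = P mod L"
    have qt: "P = q * L + t" "t < L" using Lpos by (auto simp: q_def t_def)
    have qm: "q < m" using lt by (simp add: q_def less_mult_imp_div_less)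
    define b1 where "b1 = take (L - t) \<beta>"
    define b2 where "b2 = drop (L - t) \<beta>"
    have b: "\<beta> = b1 @ b2" by (simp add: b1_def b2_def)
    have lb2: "length b2 = t" using L qt by (simp add: b2_def)
    have lb: "length b1 + t = L" using L b lb2 by (metis length_append)
    have b1n: "x \<le> n" if "x \<in> set b1" for x using that \<beta>n b by auto
    have b2n: "x \<le> n" if "x \<in> set b2" for x using that \<beta>n b by auto
    let ?N = "Suc n"
    let ?\<gamma> = "replicate q ?N @ b1 @ [?N] @ b2 @ replicate (m - q - 1) ?N"
    \<comment> \<open>Inversions across the cuts of \<open>?\<gamma>\<close>: a front copy of
      \<open>?N\<close> has all of \<open>\<beta>\<close> behind it, the middle copy has
      \<open>b2\<close>, and a letter of \<open>\<beta>\<close> gains nothing from the larger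
      \<open>?N\<close>.\<close>
    have s1: "(\<Sum>x\<leftarrow>replicate q ?N. length (filter (\<lambda>y. y < x)
        (b1 @ [?N] @ b2 @ replicate (m - q - 1) ?N))) = q * L"
      using flt[of b1] flt[of b2] lb lb2 b by (subst sum_list_eq_const[where c = L]) auto
    have s2: "(\<Sum>x\<leftarrow>b1. length (filter (\<lambda>y. y < x) ([?N] @ b2 @ replicate (m - q - 1) ?N)))
        = (\<Sum>x\<leftarrow>b1. length (filter (\<lambda>y. y < x) b2))"
      using b1n by (intro arg_cong[where f = sum_list] map_cong) (auto dest!: b1n)
    have s3: "(\<Sum>x\<leftarrow>[?N]. length (filter (\<lambda>y. y < x) (b2 @ replicate (m - q - 1) ?N))) = t"
      using flt[of b2] lb2 b by auto
    have s4: "(\<Sum>x\<leftarrow>b2. length (filter (\<lambda>y. y < x) (replicate (m - q - 1) ?N))) = 0"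
      using b2n by (subst sum_list_eq_const[where c = 0]) (auto dest!: b2n)
    have "inversions ?\<gamma> = inversions b1 + inversions b2 +
        (\<Sum>x\<leftarrow>b1. length (filter (\<lambda>y. y < x) b2)) + P"
      unfolding inversions_append[of "replicate q ?N"] s1 inversions_append[of b1] s2
        inversions_append[of "[?N]"] s3 inversions_append[of b2] s4
      using qt by (simp add: inversions_replicate)
    then have "inversions ?\<gamma> = inversions \<alpha>"
      using \<beta>(2) P(2) inversions_append[of b1 b2] b by simp
    moreover have "mset ?\<gamma> = mset \<alpha>"
    proof -
      have "replicate_mset m ?N =
          replicate_mset q ?N + {#?N#} + replicate_mset (m - q - 1) ?N"
        using qm by (intro multiset_eqI) auto
      moreover have "mset \<alpha>' = mset b1 + mset b2" using \<beta>(1) b by simp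
      ultimately show ?thesis using \<alpha> by (simp add: ac_simps)
    qed
    \<comment> \<open>Three runs of \<open>?N\<close>, and one more block from cutting
      \<open>\<beta>\<close> into \<open>b1\<close> and \<open>b2\<close>: this is the 4 added for
      each letter.\<close>
    moreover have "length (remdups_adj ?\<gamma>) \<le> 4 * Suc n"
    proof -
      have "length (remdups_adj ?\<gamma>) \<le> length (remdups_adj (replicate q ?N)) +
          (length (remdups_adj b1) + (length (remdups_adj [?N]) +
          (length (remdups_adj b2) + length (remdups_adj (replicate (m - q - 1) ?N)))))"
        by (meson add_left_mono length_remdups_adj_append_le order_trans)
      then show ?thesis
        using length_remdups_adj_split_le[of b1 b2] b \<beta>(3)
          length_remdups_adj_replicate_le[of q ?N]
          length_remdups_adj_replicate_le[of "m - q - 1" ?N] by simp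
    qed
    ultimately show ?thesis by blast
  qed
qed

text \<open>An arbitrary choice; compatibility with concatenation is claimed only modulo the ideal,
  in \<open>normalize_mult\<close>.\<close>

definition normal_form :: "nat \<Rightarrow> nat list \<Rightarrow> nat list" where
  "normal_form n \<alpha> = (SOME \<beta>. mset \<beta> = mset \<alpha> \<and> inversions \<beta> = inversions \<alpha> \<and>
     length (remdups_adj \<beta>) \<le> 4 * n)"

lemma normal_form:
  assumes "\<alpha> \<in> words n"
  shows "mset (normal_form n \<alpha>) = mset \<alpha>" "inversions (normal_form n \<alpha>) = inversions \<alpha>"
    "length (remdups_adj (normal_form n \<alpha>)) \<le> 4 * n"
    "normal_form n \<alpha> \<in> words n" "length (normal_form n \<alpha>) = length \<alpha>"
proof -
  show *: "mset (normal_form n \<alpha>) = mset \<alpha>" "inversions (normal_form n \<alpha>) = inversions \<alpha>"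
    "length (remdups_adj (normal_form n \<alpha>)) \<le> 4 * n"
    using someI_ex[OF normal_form_exists[OF assms]] unfolding normal_form_def by blast+
  show "normal_form n \<alpha> \<in> words n" using words_cong_mset[OF *(1)] assms by simp
  show "length (normal_form n \<alpha>) = length \<alpha>" using *(1) by (metis size_mset)
qed

section \<open>Weighted algebras of power series\<close>

text \<open>Both bracketings sum over the pairs of cut positions j <= k of a word; the right one
  records them as j and k - j.\<close>

lemma series_mult_assoc: "series_mult (series_mult a b) c = series_mult a (series_mult b c)"
proof
  fix \<gamma> :: "nat list"
  let ?L = "length \<gamma>"
  let ?t = "\<lambda>j k. a (take j \<gamma>) * b (take (k - j) (drop j \<gamma>)) * c (drop k \<gamma>)"
  have "series_mult (series_mult a b) c \<gamma> = (\<Sum>k\<le>?L. \<Sum>j\<le>k. ?t j k)"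
    unfolding series_mult_def
    by (intro sum.cong refl) (simp add: sum_distrib_right drop_take min_def)
  also have "\<dots> = (\<Sum>(k, j)\<in>(SIGMA k:{..?L}. {..k}). ?t j k)"
    by (simp add: sum.Sigma)
  also have "\<dots> = (\<Sum>(j, i)\<in>(SIGMA j:{..?L}. {..?L - j}). ?t j (j + i))"
    by (rule sum.reindex_bij_witness[where i = "\<lambda>(j, i). (j + i, j)" and j = "\<lambda>(k, j). (j, k - j)"])
      auto
  also have "\<dots> = (\<Sum>j\<le>?L. \<Sum>i\<le>?L - j. ?t j (j + i))"
    by (simp add: sum.Sigma)
  also have "\<dots> = series_mult a (series_mult b c) \<gamma>"
    unfolding series_mult_def
    by (intro sum.cong refl) (simp add: sum_distrib_left mult.assoc add.commute)
  finally show "series_mult (series_mult a b) c \<gamma> = series_mult a (series_mult b c) \<gamma>" .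
qed

lemma series_mult_add_left:
  "series_mult (\<lambda>\<alpha>. a \<alpha> + b \<alpha>) c = (\<lambda>\<alpha>. series_mult a c \<alpha> + series_mult b c \<alpha>)"
  by (simp add: series_mult_def fun_eq_iff sum.distrib distrib_right)

lemma series_mult_add_right:
  "series_mult a (\<lambda>\<alpha>. b \<alpha> + c \<alpha>) = (\<lambda>\<alpha>. series_mult a b \<alpha> + series_mult a c \<alpha>)"
  by (simp add: series_mult_def fun_eq_iff sum.distrib distrib_left)

lemma series_mult_diff_left:
  "series_mult (\<lambda>\<alpha>. a \<alpha> - b \<alpha>) c = (\<lambda>\<alpha>. series_mult a c \<alpha> - series_mult b c \<alpha>)"
  by (simp add: series_mult_def fun_eq_iff sum_subtractf left_diff_distrib)

lemma series_mult_diff_right: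
  "series_mult a (\<lambda>\<alpha>. b \<alpha> - c \<alpha>) = (\<lambda>\<alpha>. series_mult a b \<alpha> - series_mult a c \<alpha>)"
  by (simp add: series_mult_def fun_eq_iff sum_subtractf right_diff_distrib)

lemma series_mult_scale_left:
  "series_mult (\<lambda>\<alpha>. k * a \<alpha>) b = (\<lambda>\<alpha>. k * series_mult a b \<alpha>)"
  by (simp add: series_mult_def fun_eq_iff sum_distrib_left mult.assoc)

lemma series_mult_scale_right:
  "series_mult a (\<lambda>\<alpha>. k * b \<alpha>) = (\<lambda>\<alpha>. k * series_mult a b \<alpha>)"
  by (simp add: series_mult_def fun_eq_iff sum_distrib_left mult.left_commute)

lemma series_mult_monomial: "series_mult (monomial \<alpha>) (monomial \<beta>) = monomial (\<alpha> @ \<beta>)"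
proof
  fix \<gamma>
  have "series_mult (monomial \<alpha>) (monomial \<beta>) \<gamma> =
      (\<Sum>k\<le>length \<gamma>. if k = length \<alpha> then (if \<gamma> = \<alpha> @ \<beta> then 1 else 0) else 0)"
    unfolding series_mult_def
  proof (rule sum.cong[OF refl])
    fix k assume k: "k \<in> {..length \<gamma>}"
    have "take k \<gamma> = \<alpha> \<and> drop k \<gamma> = \<beta> \<longleftrightarrow> k = length \<alpha> \<and> \<gamma> = \<alpha> @ \<beta>"
    proof
      assume td: "take k \<gamma> = \<alpha> \<and> drop k \<gamma> = \<beta>"
      then have "\<gamma> = \<alpha> @ \<beta>" by (metis append_take_drop_id)
      moreover have "length (take k \<gamma>) = k" using k by simp
      ultimately show "k = length \<alpha> \<and> \<gamma> = \<alpha> @ \<beta>" using td by metis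
    qed simp
    then have "monomial \<alpha> (take k \<gamma>) * monomial \<beta> (drop k \<gamma>) =
        (if k = length \<alpha> \<and> \<gamma> = \<alpha> @ \<beta> then 1 else 0)"
      unfolding monomial_def by (cases "take k \<gamma> = \<alpha>"; cases "drop k \<gamma> = \<beta>") simp_all
    then show "monomial \<alpha> (take k \<gamma>) * monomial \<beta> (drop k \<gamma>) =
        (if k = length \<alpha> then (if \<gamma> = \<alpha> @ \<beta> then 1 else 0) else 0)"
      by simp
  qed
  also have "\<dots> = monomial (\<alpha> @ \<beta>) \<gamma>"
    by (auto simp: monomial_def)
  finally show "series_mult (monomial \<alpha>) (monomial \<beta>) \<gamma> = monomial (\<alpha> @ \<beta>) \<gamma>" .
qed

lemma series_mult_one_left: "series_mult (monomial []) a = a"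
proof
  fix \<gamma>
  have "series_mult (monomial []) a \<gamma> = (\<Sum>k\<le>length \<gamma>. if k = 0 then a \<gamma> else 0)"
    unfolding series_mult_def by (intro sum.cong) (auto simp: monomial_def)
  then show "series_mult (monomial []) a \<gamma> = a \<gamma>" by simp
qed

lemma series_mult_one_right: "series_mult a (monomial []) = a"
proof
  fix \<gamma>
  have "series_mult a (monomial []) \<gamma> = (\<Sum>k\<le>length \<gamma>. if k = length \<gamma> then a \<gamma> else 0)"
    unfolding series_mult_def by (intro sum.cong) (auto simp: monomial_def)
  then show "series_mult a (monomial []) \<gamma> = a \<gamma>" by simp
qed

text \<open>Treats both algebras at once. Submultiplicative weights give submultiplicative norms,
  positive weights give continuous coefficients, and a nonempty family lets the balls cover the
  carrier.\<close>

locale weight_family =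
  fixes n :: nat and W :: "(nat list \<Rightarrow> real) set"
  assumes W_nonempty: "W \<noteq> {}"
    and W_pos: "w \<in> W \<Longrightarrow> w \<alpha> > 0"
    and W_submult: "w \<in> W \<Longrightarrow> w (\<alpha> @ \<beta>) \<le> w \<alpha> * w \<beta>"
begin

abbreviation "C \<equiv> weighted_carrier n W"

lemma W_nonneg: "w \<in> W \<Longrightarrow> 0 \<le> w \<alpha>"
  using W_pos less_imp_le by blast

lemma C_summable: "a \<in> C \<Longrightarrow> w \<in> W \<Longrightarrow> (\<lambda>\<alpha>. cmod (a \<alpha>) * w \<alpha>) summable_on words n"
  by (simp add: weighted_carrier_def)

lemma C_outside: "a \<in> C \<Longrightarrow> \<alpha> \<notin> words n \<Longrightarrow> a \<alpha> = 0"
  by (simp add: weighted_carrier_def formal_series_def)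

text \<open>Together with \<open>wnorm_leI\<close> and \<open>sum_le_wnorm\<close> this turns
  questions about infinite sums into bounds on finite partial sums.\<close>

lemma CI:
  assumes "\<And>\<alpha>. \<alpha> \<notin> words n \<Longrightarrow> a \<alpha> = 0"
    and "\<And>w. w \<in> W \<Longrightarrow> \<exists>B. \<forall>S. finite S \<longrightarrow> S \<subseteq> words n \<longrightarrow> (\<Sum>\<alpha>\<in>S. cmod (a \<alpha>) * w \<alpha>) \<le> B"
  shows "a \<in> C"
  unfolding weighted_carrier_def formal_series_def
proof (intro CollectI conjI ballI allI impI assms(1))
  fix w assume w: "w \<in> W"
  obtain B where B: "\<And>S. finite S \<Longrightarrow> S \<subseteq> words n \<Longrightarrow> (\<Sum>\<alpha>\<in>S. cmod (a \<alpha>) * w \<alpha>) \<le> B"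
    using assms(2)[OF w] by blast
  show "(\<lambda>\<alpha>. cmod (a \<alpha>) * w \<alpha>) summable_on words n"
    using W_nonneg[OF w] B
    by (intro nonneg_bdd_above_summable_on bdd_aboveI2[where M = B]) auto
qed auto

lemma wnorm_leI:
  assumes "a \<in> C" "w \<in> W"
    and "\<And>S. finite S \<Longrightarrow> S \<subseteq> words n \<Longrightarrow> (\<Sum>\<alpha>\<in>S. cmod (a \<alpha>) * w \<alpha>) \<le> B"
  shows "wnorm n w a \<le> B"
  unfolding wnorm_def using assms by (intro infsum_le_finite_sums C_summable)

lemma sum_le_wnorm:
  assumes "a \<in> C" "w \<in> W" "finite S" "S \<subseteq> words n"
  shows "(\<Sum>\<alpha>\<in>S. cmod (a \<alpha>) * w \<alpha>) \<le> wnorm n w a"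
  unfolding wnorm_def using assms W_nonneg
  by (intro finite_sum_le_infsum C_summable) auto

lemma wnorm_nonneg: "w \<in> W \<Longrightarrow> 0 \<le> wnorm n w a"
  unfolding wnorm_def using W_nonneg by (intro infsum_nonneg) auto

lemma coeff_le_wnorm:
  assumes "a \<in> C" "w \<in> W"
  shows "cmod (a \<alpha>) * w \<alpha> \<le> wnorm n w a"
proof (cases "\<alpha> \<in> words n")
  case True
  then show ?thesis using sum_le_wnorm[OF assms, of "{\<alpha>}"] by simp
next
  case False
  then show ?thesis using C_outside[OF assms(1)] wnorm_nonneg[OF assms(2)] by simp
qed

lemma zero_C: "(\<lambda>\<alpha>. 0) \<in> C"
  by (rule CI) (auto intro: exI[of _ 0])

lemma wnorm_zero [simp]: "wnorm n w (\<lambda>\<alpha>. 0) = 0"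
  by (simp add: wnorm_def)

lemma finite_support_C:
  assumes "finite S" "S \<subseteq> words n" "\<And>\<alpha>. \<alpha> \<notin> S \<Longrightarrow> a \<alpha> = 0"
  shows "a \<in> C"
proof (rule CI)
  fix w assume w: "w \<in> W"
  have "(\<Sum>\<alpha>\<in>T. cmod (a \<alpha>) * w \<alpha>) \<le> (\<Sum>\<alpha>\<in>S. cmod (a \<alpha>) * w \<alpha>)" if "finite T" for T
  proof -
    have "(\<Sum>\<alpha>\<in>T. cmod (a \<alpha>) * w \<alpha>) = (\<Sum>\<alpha>\<in>T \<inter> S. cmod (a \<alpha>) * w \<alpha>)"
      using that assms by (intro sum.mono_neutral_right) auto
    also have "\<dots> \<le> (\<Sum>\<alpha>\<in>S. cmod (a \<alpha>) * w \<alpha>)"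
      using assms W_nonneg[OF w] by (intro sum_mono2) auto
    finally show ?thesis .
  qed
  then show "\<exists>B. \<forall>T. finite T \<longrightarrow> T \<subseteq> words n \<longrightarrow> (\<Sum>\<alpha>\<in>T. cmod (a \<alpha>) * w \<alpha>) \<le> B" by blast
qed (use assms in auto)

lemma monomial_C: "\<alpha> \<in> words n \<Longrightarrow> monomial \<alpha> \<in> C"
  by (rule finite_support_C[of "{\<alpha>}"]) (auto simp: monomial_def)

lemma add_C_aux:
  assumes "a \<in> C" "b \<in> C" "w \<in> W" "finite S" "S \<subseteq> words n"
  shows "(\<Sum>\<alpha>\<in>S. cmod (a \<alpha> + b \<alpha>) * w \<alpha>) \<le> wnorm n w a + wnorm n w b"
proof -
  have "(\<Sum>\<alpha>\<in>S. cmod (a \<alpha> + b \<alpha>) * w \<alpha>) \<le> (\<Sum>\<alpha>\<in>S. cmod (a \<alpha>) * w \<alpha> + cmod (b \<alpha>) * w \<alpha>)"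
    using W_nonneg[OF assms(3)]
    by (intro sum_mono) (metis distrib_right mult_right_mono norm_triangle_ineq)
  also have "\<dots> \<le> wnorm n w a + wnorm n w b"
    unfolding sum.distrib using assms by (intro add_mono sum_le_wnorm)
  finally show ?thesis .
qed

lemma add_C: "a \<in> C \<Longrightarrow> b \<in> C \<Longrightarrow> (\<lambda>\<alpha>. a \<alpha> + b \<alpha>) \<in> C"
  by (rule CI) (auto simp: C_outside intro: add_C_aux)

lemma wnorm_add:
  assumes "a \<in> C" "b \<in> C" "w \<in> W"
  shows "wnorm n w (\<lambda>\<alpha>. a \<alpha> + b \<alpha>) \<le> wnorm n w a + wnorm n w b"
  using assms by (intro wnorm_leI add_C add_C_aux)

lemma scale_C: "a \<in> C \<Longrightarrow> (\<lambda>\<alpha>. k * a \<alpha>) \<in> C"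
  unfolding weighted_carrier_def formal_series_def
  by (auto simp: norm_mult mult.assoc intro: summable_on_cmult_right)

lemma wnorm_scale: "wnorm n w (\<lambda>\<alpha>. k * a \<alpha>) = cmod k * wnorm n w a"
  unfolding wnorm_def by (simp add: norm_mult mult.assoc infsum_cmult_right')

lemma uminus_C: "a \<in> C \<Longrightarrow> (\<lambda>\<alpha>. - a \<alpha>) \<in> C"
  using scale_C[of a "-1"] by simp

lemma diff_C: "a \<in> C \<Longrightarrow> b \<in> C \<Longrightarrow> (\<lambda>\<alpha>. a \<alpha> - b \<alpha>) \<in> C"
  using add_C[OF _ uminus_C, of a b] by simp

text \<open>A word with a cut position is the same as a pair of words. The cut words from
  \<open>S\<close> thus embed into a finite rectangle of pairs, over which the sum factors.\<close>

lemma mult_C_aux: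
  assumes "a \<in> C" "b \<in> C" "w \<in> W" "finite S" "S \<subseteq> words n"
  shows "(\<Sum>\<gamma>\<in>S. cmod (series_mult a b \<gamma>) * w \<gamma>) \<le> wnorm n w a * wnorm n w b"
proof -
  let ?A = "\<lambda>\<alpha>. cmod (a \<alpha>) * w \<alpha>" and ?B = "\<lambda>\<alpha>. cmod (b \<alpha>) * w \<alpha>"
  let ?P = "SIGMA \<gamma>:S. {..length \<gamma>}"
  let ?f = "\<lambda>(\<gamma>, k). (take k \<gamma>, drop k \<gamma>) :: nat list \<times> nat list"
  have finP: "finite ?P" using assms(4) by blast
  have inj: "inj_on ?f ?P"
  proof (rule inj_onI)
    fix x y assume "x \<in> ?P" "y \<in> ?P" "?f x = ?f y"
    then have "snd x \<le> length (fst x)" "snd y \<le> length (fst y)"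
      "take (snd x) (fst x) = take (snd y) (fst y)" "drop (snd x) (fst x) = drop (snd y) (fst y)"
      by auto
    then show "x = y"
      by (metis append_take_drop_id length_take min.absorb2 prod_eqI)
  qed
  have "(\<Sum>\<gamma>\<in>S. cmod (series_mult a b \<gamma>) * w \<gamma>)
      \<le> (\<Sum>\<gamma>\<in>S. \<Sum>k\<le>length \<gamma>. ?A (take k \<gamma>) * ?B (drop k \<gamma>))"
  proof (rule sum_mono)
    fix \<gamma>
    have "cmod (series_mult a b \<gamma>) * w \<gamma>
        \<le> (\<Sum>k\<le>length \<gamma>. cmod (a (take k \<gamma>) * b (drop k \<gamma>))) * w \<gamma>"
      unfolding series_mult_def by (intro mult_right_mono norm_sum W_nonneg assms)
    also have "\<dots> \<le> (\<Sum>k\<le>length \<gamma>. ?A (take k \<gamma>) * ?B (drop k \<gamma>))"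
      unfolding sum_distrib_right
    proof (rule sum_mono)
      fix k
      have "cmod (a (take k \<gamma>) * b (drop k \<gamma>)) * w \<gamma>
          \<le> cmod (a (take k \<gamma>) * b (drop k \<gamma>)) * (w (take k \<gamma>) * w (drop k \<gamma>))"
        using W_submult[OF assms(3), of "take k \<gamma>" "drop k \<gamma>"] by (intro mult_left_mono) auto
      then show "cmod (a (take k \<gamma>) * b (drop k \<gamma>)) * w \<gamma> \<le> ?A (take k \<gamma>) * ?B (drop k \<gamma>)"
        by (simp add: norm_mult ac_simps)
    qed
    finally show "cmod (series_mult a b \<gamma>) * w \<gamma>
        \<le> (\<Sum>k\<le>length \<gamma>. ?A (take k \<gamma>) * ?B (drop k \<gamma>))" .
  qed
  also have "\<dots> = (\<Sum>x\<in>?P. (\<lambda>(\<alpha>, \<beta>). ?A \<alpha> * ?B \<beta>) (?f x))"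
    using assms(4) by (simp add: sum.Sigma case_prod_beta)
  also have "\<dots> = (\<Sum>(\<alpha>, \<beta>)\<in>?f ` ?P. ?A \<alpha> * ?B \<beta>)"
    using inj by (simp add: sum.reindex)
  also have "\<dots> \<le> (\<Sum>(\<alpha>, \<beta>)\<in>fst ` ?f ` ?P \<times> snd ` ?f ` ?P. ?A \<alpha> * ?B \<beta>)"
    using finP W_nonneg[OF assms(3)]
    by (intro sum_mono2 finite_cartesian_product finite_imageI) (force simp: image_iff)+
  also have "\<dots> = (\<Sum>\<alpha>\<in>fst ` ?f ` ?P. ?A \<alpha>) * (\<Sum>\<beta>\<in>snd ` ?f ` ?P. ?B \<beta>)"
    by (simp add: sum_product sum.cartesian_product)
  also have "\<dots> \<le> wnorm n w a * wnorm n w b"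
  proof -
    have sub: "fst ` ?f ` ?P \<subseteq> words n" "snd ` ?f ` ?P \<subseteq> words n"
      using assms(5) by (force simp: words_def dest: in_set_takeD in_set_dropD)+
    show ?thesis
      by (rule mult_mono[OF sum_le_wnorm[OF assms(1,3) _ sub(1)] sum_le_wnorm[OF assms(2,3) _ sub(2)]])
        (intro finite_imageI finP wnorm_nonneg sum_nonneg mult_nonneg_nonneg norm_ge_zero W_nonneg assms(3))+
  qed
  finally show ?thesis .
qed

lemma mult_C:
  assumes "a \<in> C" "b \<in> C"
  shows "series_mult a b \<in> C"
proof (rule CI)
  fix \<gamma> assume "\<gamma> \<notin> words n"
  then have "take k \<gamma> \<notin> words n \<or> drop k \<gamma> \<notin> words n" for k
    using words_append[of "take k \<gamma>" "drop k \<gamma>" n] by auto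
  then have "a (take k \<gamma>) * b (drop k \<gamma>) = 0" for k
    using C_outside[OF assms(1)] C_outside[OF assms(2)] by (metis mult_eq_0_iff)
  then show "series_mult a b \<gamma> = 0" unfolding series_mult_def by (intro sum.neutral) auto
qed (use mult_C_aux[OF assms] in blast)

lemma wnorm_mult:
  assumes "a \<in> C" "b \<in> C" "w \<in> W"
  shows "wnorm n w (series_mult a b) \<le> wnorm n w a * wnorm n w b"
  using assms by (intro wnorm_leI mult_C mult_C_aux)

abbreviation "F \<equiv> weighted_alg n W"

lemma F_sel [simp]:
  "carrier F = C" "mult F = series_mult" "one F = monomial []" "zero F = (\<lambda>\<alpha>. 0)"
  "add F = (\<lambda>a b \<alpha>. a \<alpha> + b \<alpha>)" "smult F = (\<lambda>c a \<alpha>. c * a \<alpha>)"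
  by (simp_all add: weighted_alg_def)

lemma ring_F: "ring F"
proof (rule ringI)
  show "abelian_group F"
  proof (rule abelian_groupI)
    fix x assume "x \<in> carrier F"
    then show "\<exists>y\<in>carrier F. y \<oplus>\<^bsub>F\<^esub> x = \<zero>\<^bsub>F\<^esub>"
      using uminus_C by (intro bexI[of _ "\<lambda>\<alpha>. - x \<alpha>"]) auto
  qed (auto simp: add_C zero_C)
  show "monoid F"
    by (rule monoidI) (auto simp: mult_C monomial_C series_mult_assoc series_mult_one_left series_mult_one_right)
qed (auto simp: series_mult_add_left series_mult_add_right)

lemma F_minus: "a \<in> C \<Longrightarrow> b \<in> C \<Longrightarrow> a \<ominus>\<^bsub>F\<^esub> b = (\<lambda>\<alpha>. a \<alpha> - b \<alpha>)"
proof -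
  assume a: "a \<in> C" "b \<in> C"
  interpret ring F by (rule ring_F)
  have "\<ominus>\<^bsub>F\<^esub> b = (\<lambda>\<alpha>. - b \<alpha>)"
    using a uminus_C by (intro minus_equality) auto
  then show ?thesis by (simp add: a_minus_def)
qed

end

lemma eventually_Cx: "z \<in> Cx \<Longrightarrow> \<forall>\<^sub>F w in nhds z. w \<in> Cx"
  unfolding Cx_def by (intro eventually_nhds_in_open) auto

lemma eventually_at_Cx: "z \<in> Cx \<Longrightarrow> \<forall>\<^sub>F w in at z. w \<in> Cx"
  using eventually_Cx eventually_nhds_conv_at by blast

text \<open>Convergence need only be tested on the generating sets: "eventually" survives finite
  intersections, and a union is handled by the member that contains the limit.\<close>

lemma limitin_topology_generated_byI:
  assumes "l \<in> \<Union>S" "\<And>U. U \<in> S \<Longrightarrow> l \<in> U \<Longrightarrow> \<forall>\<^sub>F t in G. x t \<in> U"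
  shows "limitin (topology_generated_by S) x l G"
  unfolding limitin_def
proof (intro conjI allI impI)
  show "l \<in> topspace (topology_generated_by S)" using assms(1) by simp
  fix U assume "openin (topology_generated_by S) U \<and> l \<in> U"
  then have "generate_topology_on S U" "l \<in> U"
    by (auto simp: openin_topology_generated_by_iff)
  then show "\<forall>\<^sub>F t in G. x t \<in> U"
  proof induction
    case (Int a b)
    then show ?case by (auto intro: eventually_conj)
  next
    case (UN K)
    then obtain k where "k \<in> K" "l \<in> k" by blast
    then have "\<forall>\<^sub>F t in G. x t \<in> k" using UN by blast
    then show ?case by eventually_elim (use \<open>k \<in> K\<close> in blast)
  qed (use assms in auto)
qed

section \<open>Convergence in a weighted algebra\<close>

context weight_family
begin

text \<open>
  Convergence in the topology of \<open>F\<close>. The values \<open>x t\<close> need to lie in \<open>C\<close> only eventually, because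
  holomorphic functions take the junk value \<^const>\<open>undefined\<close> at \<open>0\<close>.
\<close>

definition cnv :: "('b \<Rightarrow> series) \<Rightarrow> series \<Rightarrow> 'b filter \<Rightarrow> bool" where
  "cnv x a G \<longleftrightarrow> a \<in> C \<and> (\<forall>\<^sub>F t in G. x t \<in> C) \<and>
     (\<forall>w\<in>W. ((\<lambda>t. wnorm n w (\<lambda>\<alpha>. x t \<alpha> - a \<alpha>)) \<longlongrightarrow> 0) G)"

lemma cnvI:
  assumes "a \<in> C" "\<forall>\<^sub>F t in G. x t \<in> C"
    and "\<And>w. w \<in> W \<Longrightarrow> \<exists>g. (g \<longlongrightarrow> 0) G \<and> (\<forall>\<^sub>F t in G. wnorm n w (\<lambda>\<alpha>. x t \<alpha> - a \<alpha>) \<le> g t)"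
  shows "cnv x a G"
  unfolding cnv_def
proof (intro conjI ballI assms(1,2))
  fix w assume w: "w \<in> W"
  then obtain g where g: "(g \<longlongrightarrow> 0) G" "\<forall>\<^sub>F t in G. wnorm n w (\<lambda>\<alpha>. x t \<alpha> - a \<alpha>) \<le> g t"
    using assms(3) by blast
  have "\<forall>\<^sub>F t in G. 0 \<le> wnorm n w (\<lambda>\<alpha>. x t \<alpha> - a \<alpha>)"
    using wnorm_nonneg[OF w] by (intro always_eventually) blast
  then show "((\<lambda>t. wnorm n w (\<lambda>\<alpha>. x t \<alpha> - a \<alpha>)) \<longlongrightarrow> 0) G"
    by (rule real_tendsto_sandwich[OF _ g(2) tendsto_const g(1)])
qed

lemma cnv_C: "cnv x a G \<Longrightarrow> a \<in> C"
  and cnv_eventually: "cnv x a G \<Longrightarrow> \<forall>\<^sub>F t in G. x t \<in> C"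
  and cnv_tendsto: "cnv x a G \<Longrightarrow> w \<in> W \<Longrightarrow> ((\<lambda>t. wnorm n w (\<lambda>\<alpha>. x t \<alpha> - a \<alpha>)) \<longlongrightarrow> 0) G"
  by (auto simp: cnv_def)

lemma cnv_cong:
  assumes "\<forall>\<^sub>F t in G. x t = y t" "cnv x a G"
  shows "cnv y a G"
proof (rule cnvI)
  show "\<forall>\<^sub>F t in G. y t \<in> C" using assms(1) cnv_eventually[OF assms(2)] by eventually_elim simp
  fix w assume "w \<in> W"
  moreover have "\<forall>\<^sub>F t in G. wnorm n w (\<lambda>\<alpha>. y t \<alpha> - a \<alpha>) \<le> wnorm n w (\<lambda>\<alpha>. x t \<alpha> - a \<alpha>)"
    using assms(1) by eventually_elim simp
  ultimately show "\<exists>g. (g \<longlongrightarrow> 0) G \<and> (\<forall>\<^sub>F t in G. wnorm n w (\<lambda>\<alpha>. y t \<alpha> - a \<alpha>) \<le> g t)"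
    using cnv_tendsto[OF assms(2)] by blast
qed (rule cnv_C[OF assms(2)])

lemma cnv_const: "a \<in> C \<Longrightarrow> cnv (\<lambda>_. a) a G"
  by (simp add: cnv_def)

lemma cnv_add:
  assumes "cnv x a G" "cnv y b G"
  shows "cnv (\<lambda>t \<alpha>. x t \<alpha> + y t \<alpha>) (\<lambda>\<alpha>. a \<alpha> + b \<alpha>) G"
proof (rule cnvI)
  show "(\<lambda>\<alpha>. a \<alpha> + b \<alpha>) \<in> C" using assms by (intro add_C cnv_C)
  show "\<forall>\<^sub>F t in G. (\<lambda>\<alpha>. x t \<alpha> + y t \<alpha>) \<in> C"
    using cnv_eventually[OF assms(1)] cnv_eventually[OF assms(2)]
    by eventually_elim (rule add_C)
  fix w assume w: "w \<in> W"
  let ?g = "\<lambda>t. wnorm n w (\<lambda>\<alpha>. x t \<alpha> - a \<alpha>) + wnorm n w (\<lambda>\<alpha>. y t \<alpha> - b \<alpha>)"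
  have "(?g \<longlongrightarrow> 0 + 0) G" by (intro tendsto_add cnv_tendsto assms w)
  moreover have "\<forall>\<^sub>F t in G. wnorm n w (\<lambda>\<alpha>. x t \<alpha> + y t \<alpha> - (a \<alpha> + b \<alpha>)) \<le> ?g t"
    using cnv_eventually[OF assms(1)] cnv_eventually[OF assms(2)]
  proof eventually_elim
    case (elim t)
    then show ?case
      using wnorm_add[OF diff_C[of "x t" a] diff_C[of "y t" b] w] assms
      by (simp add: cnv_C algebra_simps)
  qed
  ultimately show "\<exists>g. (g \<longlongrightarrow> 0) G \<and>
      (\<forall>\<^sub>F t in G. wnorm n w (\<lambda>\<alpha>. x t \<alpha> + y t \<alpha> - (a \<alpha> + b \<alpha>)) \<le> g t)"
    by auto
qed

lemma cnv_scale:
  assumes "(c \<longlongrightarrow> k) G" "cnv x a G"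
  shows "cnv (\<lambda>t \<alpha>. c t * x t \<alpha>) (\<lambda>\<alpha>. k * a \<alpha>) G"
proof (rule cnvI)
  show "(\<lambda>\<alpha>. k * a \<alpha>) \<in> C" using assms by (intro scale_C cnv_C)
  show "\<forall>\<^sub>F t in G. (\<lambda>\<alpha>. c t * x t \<alpha>) \<in> C"
    using cnv_eventually[OF assms(2)] by eventually_elim (rule scale_C)
  fix w assume w: "w \<in> W"
  let ?g = "\<lambda>t. cmod (c t) * wnorm n w (\<lambda>\<alpha>. x t \<alpha> - a \<alpha>) + cmod (c t - k) * wnorm n w a"
  have "(?g \<longlongrightarrow> cmod k * 0 + cmod (k - k) * wnorm n w a) G"
    by (intro tendsto_intros cnv_tendsto assms w)
  moreover have "\<forall>\<^sub>F t in G. wnorm n w (\<lambda>\<alpha>. c t * x t \<alpha> - k * a \<alpha>) \<le> ?g t"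
    using cnv_eventually[OF assms(2)]
  proof eventually_elim
    case (elim t)
    have "(\<lambda>\<alpha>. c t * x t \<alpha> - k * a \<alpha>) = (\<lambda>\<alpha>. c t * (x t \<alpha> - a \<alpha>) + (c t - k) * a \<alpha>)"
      by (simp add: algebra_simps)
    then show ?case
      using wnorm_add[OF scale_C[OF diff_C[of "x t" a]] scale_C[of a] w, of "c t" "c t - k"]
        elim assms(2) by (simp add: cnv_C wnorm_scale)
  qed
  ultimately show "\<exists>g. (g \<longlongrightarrow> 0) G \<and>
      (\<forall>\<^sub>F t in G. wnorm n w (\<lambda>\<alpha>. c t * x t \<alpha> - k * a \<alpha>) \<le> g t)"
    by auto
qed

lemma cnv_diff:
  assumes "cnv x a G" "cnv y b G"
  shows "cnv (\<lambda>t \<alpha>. x t \<alpha> - y t \<alpha>) (\<lambda>\<alpha>. a \<alpha> - b \<alpha>) G"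
  using cnv_add[OF assms(1) cnv_scale[OF tendsto_const[of "-1"] assms(2)]] by simp

lemma cnv_mult:
  assumes "cnv x a G" "cnv y b G"
  shows "cnv (\<lambda>t. series_mult (x t) (y t)) (series_mult a b) G"
proof (rule cnvI)
  have ab: "a \<in> C" "b \<in> C" using assms by (auto intro: cnv_C)
  then show "series_mult a b \<in> C" by (rule mult_C)
  show "\<forall>\<^sub>F t in G. series_mult (x t) (y t) \<in> C"
    using cnv_eventually[OF assms(1)] cnv_eventually[OF assms(2)]
    by eventually_elim (rule mult_C)
  fix w assume w: "w \<in> W"
  let ?p = "\<lambda>t. wnorm n w (\<lambda>\<alpha>. x t \<alpha> - a \<alpha>)" and ?q = "\<lambda>t. wnorm n w (\<lambda>\<alpha>. y t \<alpha> - b \<alpha>)"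
  let ?g = "\<lambda>t. ?p t * ?q t + ?p t * wnorm n w b + wnorm n w a * ?q t"
  have "(?g \<longlongrightarrow> 0 * 0 + 0 * wnorm n w b + wnorm n w a * 0) G"
    by (intro tendsto_intros cnv_tendsto assms w)
  moreover have "\<forall>\<^sub>F t in G. wnorm n w (\<lambda>\<alpha>. series_mult (x t) (y t) \<alpha> - series_mult a b \<alpha>) \<le> ?g t"
    using cnv_eventually[OF assms(1)] cnv_eventually[OF assms(2)]
  proof eventually_elim
    case (elim t)
    let ?u = "\<lambda>\<alpha>. x t \<alpha> - a \<alpha>" and ?v = "\<lambda>\<alpha>. y t \<alpha> - b \<alpha>"
    have uv: "?u \<in> C" "?v \<in> C" using elim ab by (auto intro: diff_C)
    \<comment> \<open>Expanding around the limits leaves in each term a factor that tends to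
      0.\<close>
    have eq: "(\<lambda>\<alpha>. series_mult (x t) (y t) \<alpha> - series_mult a b \<alpha>) =
        (\<lambda>\<alpha>. series_mult ?u ?v \<alpha> + series_mult ?u b \<alpha> + series_mult a ?v \<alpha>)"
      by (simp add: series_mult_diff_left series_mult_diff_right)
    have "wnorm n w (\<lambda>\<alpha>. series_mult ?u ?v \<alpha> + series_mult ?u b \<alpha> + series_mult a ?v \<alpha>)
        \<le> wnorm n w (series_mult ?u ?v) + wnorm n w (series_mult ?u b) + wnorm n w (series_mult a ?v)"
      using wnorm_add[OF add_C[OF mult_C[OF uv] mult_C[OF uv(1) ab(2)]] mult_C[OF ab(1) uv(2)] w]
        wnorm_add[OF mult_C[OF uv] mult_C[OF uv(1) ab(2)] w] by linarith
    also have "\<dots> \<le> ?g t"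
      using uv ab w by (intro add_mono wnorm_mult)
    finally show ?case unfolding eq .
  qed
  ultimately show "\<exists>g. (g \<longlongrightarrow> 0) G \<and>
      (\<forall>\<^sub>F t in G. wnorm n w (\<lambda>\<alpha>. series_mult (x t) (y t) \<alpha> - series_mult a b \<alpha>) \<le> g t)"
    by auto
qed

text \<open>A coefficient is a continuous functional because the weight of its word is
  positive.\<close>

lemma cnv_coeff:
  assumes "cnv x a G"
  shows "((\<lambda>t. x t \<alpha>) \<longlongrightarrow> a \<alpha>) G"
proof -
  obtain w where w: "w \<in> W" using W_nonempty by blast
  let ?g = "\<lambda>t. wnorm n w (\<lambda>\<alpha>. x t \<alpha> - a \<alpha>) / w \<alpha>"
  have "(?g \<longlongrightarrow> 0) G"
    using cnv_tendsto[OF assms w] by (rule tendsto_divide_zero)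
  moreover have "\<forall>\<^sub>F t in G. norm (x t \<alpha> - a \<alpha>) \<le> ?g t"
    using cnv_eventually[OF assms]
  proof eventually_elim
    case (elim t)
    show ?case
      using coeff_le_wnorm[OF diff_C[OF elim cnv_C[OF assms]] w, of \<alpha>] W_pos[OF w, of \<alpha>]
      by (simp add: pos_le_divide_eq)
  qed
  ultimately have "((\<lambda>t. x t \<alpha> - a \<alpha>) \<longlongrightarrow> 0) G"
    by (rule Lim_null_comparison[rotated])
  then show ?thesis by (rule LIM_zero_cancel)
qed

abbreviation wball :: "(nat list \<Rightarrow> real) \<Rightarrow> series \<Rightarrow> real \<Rightarrow> series set" where
  "wball w a e \<equiv> {b \<in> C. wnorm n w (\<lambda>\<alpha>. b \<alpha> - a \<alpha>) < e}"

lemma topo_F: "topo F = topology_generated_by {wball w a e | w a e. w \<in> W \<and> a \<in> C \<and> e > 0}"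
  by (simp add: weighted_alg_def)

lemma openin_wball: "w \<in> W \<Longrightarrow> a \<in> C \<Longrightarrow> e > 0 \<Longrightarrow> openin (topo F) (wball w a e)"
  unfolding topo_F by (rule topology_generated_by_Basis) blast

lemma centre_wball: "a \<in> C \<Longrightarrow> e > 0 \<Longrightarrow> a \<in> wball w a e"
  by simp

lemma Union_wballs: "\<Union>{wball w a e | w a e. w \<in> W \<and> a \<in> C \<and> e > 0} = C"
proof (intro equalityI subsetI)
  fix a assume a: "a \<in> C"
  obtain w where "w \<in> W" using W_nonempty by blast
  then show "a \<in> \<Union>{wball w a e | w a e. w \<in> W \<and> a \<in> C \<and> e > 0}"
    using a by (intro UnionI[of "wball w a 1"] CollectI exI[of _ w] exI[of _ a] exI[of _ "1::real"])
      (simp_all add: centre_wball)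
qed blast

lemma topspace_F [simp]: "topspace (topo F) = C"
  unfolding topo_F topology_generated_by_topspace by (rule Union_wballs)

lemma openin_FI:
  assumes "U \<subseteq> C"
    and "\<And>a. a \<in> U \<Longrightarrow> \<exists>w\<in>W. \<exists>e>0. wball w a e \<subseteq> U"
  shows "openin (topo F) U"
proof (subst openin_subopen, intro ballI)
  fix a assume a: "a \<in> U"
  then obtain w e where "w \<in> W" "e > 0" "wball w a e \<subseteq> U" using assms(2) by blast
  moreover have "a \<in> C" using a assms(1) by blast
  ultimately show "\<exists>T. openin (topo F) T \<and> a \<in> T \<and> T \<subseteq> U"
    using openin_wball centre_wball by (intro exI[of _ "wball w a e"]) auto
qed

lemma limitin_F: "limitin (topo F) x a G \<longleftrightarrow> cnv x a G"
proof
  assume lim: "limitin (topo F) x a G"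
  then have a: "a \<in> C" by (simp add: limitin_def)
  show "cnv x a G" unfolding cnv_def
  proof (intro conjI ballI a)
    show "\<forall>\<^sub>F t in G. x t \<in> C"
      using lim a unfolding limitin_def by (metis openin_topspace topspace_F)
    fix w assume w: "w \<in> W"
    show "((\<lambda>t. wnorm n w (\<lambda>\<alpha>. x t \<alpha> - a \<alpha>)) \<longlongrightarrow> 0) G"
    proof (rule tendstoI)
      fix e :: real assume e: "e > 0"
      have "\<forall>\<^sub>F t in G. x t \<in> wball w a e"
        using lim openin_wball[OF w a e] centre_wball[OF a e] unfolding limitin_def by blast
      then show "\<forall>\<^sub>F t in G. dist (wnorm n w (\<lambda>\<alpha>. x t \<alpha> - a \<alpha>)) 0 < e"
        by eventually_elim (simp add: wnorm_nonneg w)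
    qed
  qed
next
  assume cnv: "cnv x a G"
  show "limitin (topo F) x a G"
    unfolding topo_F
  proof (rule limitin_topology_generated_byI)
    show "a \<in> \<Union>{wball w a e | w a e. w \<in> W \<and> a \<in> C \<and> e > 0}"
      unfolding Union_wballs by (rule cnv_C[OF cnv])
    \<comment> \<open>The generating balls need not be centred at the limit, hence the triangle
      inequality with the remaining gap.\<close>
    fix U assume "U \<in> {wball w a e | w a e. w \<in> W \<and> a \<in> C \<and> e > 0}" "a \<in> U"
    then obtain w b e where U: "U = wball w b e" and w: "w \<in> W" and b: "b \<in> C"
      and e: "wnorm n w (\<lambda>\<alpha>. a \<alpha> - b \<alpha>) < e" and a: "a \<in> C" by auto
    have "\<forall>\<^sub>F t in G. wnorm n w (\<lambda>\<alpha>. x t \<alpha> - a \<alpha>) < e - wnorm n w (\<lambda>\<alpha>. a \<alpha> - b \<alpha>)"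
      using order_tendstoD(2)[OF cnv_tendsto[OF cnv w]] e by simp
    then show "\<forall>\<^sub>F t in G. x t \<in> U"
      using cnv_eventually[OF cnv]
    proof eventually_elim
      case (elim t)
      then show ?case
        using wnorm_add[OF diff_C[of "x t" a] diff_C[of a b] w] a b U by simp
    qed
  qed
qed

end

text \<open>Continuous linear maps, described by norm estimates; the instances are the inclusion,
  truncation and passage to normal forms. Linearity is asked for all functions, so that
  \<open>T\<close> can be moved through difference quotients without membership conditions.\<close>

locale weight_map = src: weight_family n W + tgt: weight_family n V
  for n :: nat and W V :: "(nat list \<Rightarrow> real) set" +
  fixes T :: "series \<Rightarrow> series"
  assumes T_diff: "T (\<lambda>\<alpha>. a \<alpha> - b \<alpha>) = (\<lambda>\<alpha>. T a \<alpha> - T b \<alpha>)"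
    and T_scale: "T (\<lambda>\<alpha>. k * a \<alpha>) = (\<lambda>\<alpha>. k * T a \<alpha>)"
    and T_C: "a \<in> src.C \<Longrightarrow> T a \<in> tgt.C"
    and T_bound: "v \<in> V \<Longrightarrow> \<exists>w\<in>W. \<exists>c. \<forall>a\<in>src.C. wnorm n v (T a) \<le> c * wnorm n w a"
begin

text \<open>The constant becomes a divisor in \<open>continuous_map_T\<close>.\<close>

lemma T_bound_pos:
  assumes "v \<in> V"
  obtains w c where "w \<in> W" "c > 0" "\<And>a. a \<in> src.C \<Longrightarrow> wnorm n v (T a) \<le> c * wnorm n w a"
proof -
  obtain w c where wc: "w \<in> W" "\<forall>a\<in>src.C. wnorm n v (T a) \<le> c * wnorm n w a"
    using T_bound[OF assms] by blast
  show thesis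
  proof (rule that[of w "max c 1"])
    fix a assume "a \<in> src.C"
    then have "wnorm n v (T a) \<le> c * wnorm n w a" using wc by blast
    also have "\<dots> \<le> max c 1 * wnorm n w a"
      using src.wnorm_nonneg[OF wc(1)] by (intro mult_right_mono) auto
    finally show "wnorm n v (T a) \<le> max c 1 * wnorm n w a" .
  qed (use wc in auto)
qed

lemma cnv_map:
  assumes "src.cnv x a G"
  shows "tgt.cnv (\<lambda>t. T (x t)) (T a) G"
proof (rule tgt.cnvI)
  show "T a \<in> tgt.C" using assms by (intro T_C src.cnv_C)
  show "\<forall>\<^sub>F t in G. T (x t) \<in> tgt.C"
    using src.cnv_eventually[OF assms] by eventually_elim (rule T_C)
  fix v assume "v \<in> V"
  then obtain w c where wc: "w \<in> W" "\<And>a. a \<in> src.C \<Longrightarrow> wnorm n v (T a) \<le> c * wnorm n w a"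
    by (rule T_bound_pos) blast
  have "((\<lambda>t. c * wnorm n w (\<lambda>\<alpha>. x t \<alpha> - a \<alpha>)) \<longlongrightarrow> c * 0) G"
    by (intro tendsto_intros src.cnv_tendsto assms wc)
  moreover have "\<forall>\<^sub>F t in G. wnorm n v (\<lambda>\<alpha>. T (x t) \<alpha> - T a \<alpha>) \<le> c * wnorm n w (\<lambda>\<alpha>. x t \<alpha> - a \<alpha>)"
    using src.cnv_eventually[OF assms]
    by eventually_elim
      (use wc(2) src.diff_C src.cnv_C[OF assms] in \<open>simp add: T_diff[symmetric]\<close>)
  ultimately show "\<exists>g. (g \<longlongrightarrow> 0) G \<and> (\<forall>\<^sub>F t in G. wnorm n v (\<lambda>\<alpha>. T (x t) \<alpha> - T a \<alpha>) \<le> g t)"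
    by auto
qed

lemma continuous_map_T: "continuous_map (topo src.F) (topo tgt.F) T"
  unfolding tgt.topo_F
proof (rule continuous_on_generated_topo)
  fix U assume "U \<in> {tgt.wball v b e | v b e. v \<in> V \<and> b \<in> tgt.C \<and> e > 0}"
  then obtain v b e where U: "U = tgt.wball v b e" and v: "v \<in> V" and b: "b \<in> tgt.C" by blast
  obtain w c where wc: "w \<in> W" "c > 0" "\<And>a. a \<in> src.C \<Longrightarrow> wnorm n v (T a) \<le> c * wnorm n w a"
    using T_bound_pos[OF v] by metis
  show "openin (topo src.F) (T -` U \<inter> topspace (topo src.F))"
  proof (rule src.openin_FI)
    fix a assume "a \<in> T -` U \<inter> topspace (topo src.F)"
    then have a: "a \<in> src.C" and lt: "wnorm n v (\<lambda>\<alpha>. T a \<alpha> - b \<alpha>) < e" by (auto simp: U)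
    define d where "d = (e - wnorm n v (\<lambda>\<alpha>. T a \<alpha> - b \<alpha>)) / c"
    have d: "d > 0" using lt wc by (simp add: d_def)
    have "x \<in> T -` U \<inter> topspace (topo src.F)" if x: "x \<in> src.wball w a d" for x
    proof -
      have xC: "x \<in> src.C" and xd: "wnorm n w (\<lambda>\<alpha>. x \<alpha> - a \<alpha>) < d" using x by auto
      have "wnorm n v (\<lambda>\<alpha>. T x \<alpha> - T a \<alpha>) \<le> c * wnorm n w (\<lambda>\<alpha>. x \<alpha> - a \<alpha>)"
        using wc(3)[OF src.diff_C[OF xC a]] by (simp add: T_diff)
      also have "\<dots> < e - wnorm n v (\<lambda>\<alpha>. T a \<alpha> - b \<alpha>)"
        using xd wc(2) by (simp add: d_def pos_less_divide_eq mult.commute)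
      finally have "wnorm n v (\<lambda>\<alpha>. T x \<alpha> - b \<alpha>) < e"
        using tgt.wnorm_add[OF tgt.diff_C[OF T_C[OF xC] T_C[OF a]] tgt.diff_C[OF T_C[OF a] b] v]
        by simp
      then show ?thesis using xC T_C U by simp
    qed
    then show "\<exists>w\<in>W. \<exists>d>0. src.wball w a d \<subseteq> T -` U \<inter> topspace (topo src.F)"
      using wc(1) d by blast
  qed auto
next
  show "T ` topspace (topo src.F) \<subseteq> \<Union>{tgt.wball v b e | v b e. v \<in> V \<and> b \<in> tgt.C \<and> e > 0}"
    unfolding tgt.Union_wballs using T_C by auto
qed

end

section \<open>Holomorphic functions and the closed ideal of relators\<close>

text \<open>The quotient in \<open>hol_carrier\<close>, computed coefficientwise. The subtraction of
  the ring \<open>F\<close> is known to agree with it only when both values lie in \<open>C\<close>,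
  hence for w near z, which is enough for the limit.\<close>

definition diff_quot :: "(complex \<Rightarrow> series) \<Rightarrow> complex \<Rightarrow> complex \<Rightarrow> series" where
  "diff_quot f z w = (\<lambda>\<alpha>. inverse (w - z) * (f w \<alpha> - f z \<alpha>))"

definition relator :: "nat \<Rightarrow> nat \<Rightarrow> complex \<Rightarrow> series" where
  "relator i j = (\<lambda>z\<in>Cx. \<lambda>\<alpha>. monomial [i, j] \<alpha> - z * monomial [j, i] \<alpha>)"

lemma holomorphic_diff_quot:
  assumes "h holomorphic_on Cx" "z \<in> Cx"
  shows "((\<lambda>w. inverse (w - z) * (h w - h z)) \<longlongrightarrow> deriv h z) (at z)"
    and "(h \<longlongrightarrow> h z) (at z)"
proof -
  have "open Cx" by (auto simp: Cx_def)
  then have d: "(h has_field_derivative deriv h z) (at z)"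
    using assms holomorphic_derivI by blast
  then show "((\<lambda>w. inverse (w - z) * (h w - h z)) \<longlongrightarrow> deriv h z) (at z)"
    by (simp add: has_field_derivative_iff divide_inverse mult.commute)
  show "(h \<longlongrightarrow> h z) (at z)"
    using DERIV_isCont[OF d] by (simp add: isCont_def)
qed

context weight_family
begin

abbreviation "H \<equiv> hol_carrier F"
abbreviation "A \<equiv> hol_alg F"

lemma hol_iff:
  "f \<in> H \<longleftrightarrow> f \<in> Cx \<rightarrow>\<^sub>E C \<and> (\<forall>z\<in>Cx. \<exists>l. cnv (diff_quot f z) l (at z))"
proof -
  have "(\<forall>z\<in>Cx. \<exists>l. limitin (topo F) (\<lambda>w. inverse (w - z) \<odot>\<^bsub>F\<^esub> (f w \<ominus>\<^bsub>F\<^esub> f z)) l (at z)) \<longleftrightarrow>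
      (\<forall>z\<in>Cx. \<exists>l. cnv (diff_quot f z) l (at z))" if f: "f \<in> Cx \<rightarrow>\<^sub>E C"
  proof (intro ball_cong refl ex_cong1)
    fix z l assume z: "z \<in> Cx"
    have eq: "\<forall>\<^sub>F w in at z. inverse (w - z) \<odot>\<^bsub>F\<^esub> (f w \<ominus>\<^bsub>F\<^esub> f z) = diff_quot f z w"
      using eventually_at_Cx[OF z]
    proof eventually_elim
      case (elim w)
      then have "f w \<in> C" "f z \<in> C" using f z by auto
      then show ?case by (simp add: F_minus diff_quot_def)
    qed
    then have eq': "\<forall>\<^sub>F w in at z. diff_quot f z w = inverse (w - z) \<odot>\<^bsub>F\<^esub> (f w \<ominus>\<^bsub>F\<^esub> f z)"
      by eventually_elim simp
    show "limitin (topo F) (\<lambda>w. inverse (w - z) \<odot>\<^bsub>F\<^esub> (f w \<ominus>\<^bsub>F\<^esub> f z)) l (at z) \<longleftrightarrow>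
        cnv (diff_quot f z) l (at z)"
      unfolding limitin_F using cnv_cong[OF eq] cnv_cong[OF eq'] by blast
  qed
  then show ?thesis unfolding hol_carrier_def F_sel by blast
qed

lemma hol_C: "f \<in> H \<Longrightarrow> z \<in> Cx \<Longrightarrow> f z \<in> C"
  by (auto simp: hol_iff)

lemma hol_restrict: "f \<in> H \<Longrightarrow> (\<lambda>z\<in>Cx. f z) = f"
  by (auto simp: hol_iff extensional_restrict PiE_def)

lemma holD: "f \<in> H \<Longrightarrow> z \<in> Cx \<Longrightarrow> \<exists>l. cnv (diff_quot f z) l (at z)"
  by (auto simp: hol_iff)

lemma holI:
  assumes "\<And>z. z \<in> Cx \<Longrightarrow> g z \<in> C" "\<And>z. z \<in> Cx \<Longrightarrow> \<exists>l. cnv (diff_quot g z) l (at z)"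
  shows "(\<lambda>z\<in>Cx. g z) \<in> H"
  unfolding hol_iff
proof (intro conjI ballI)
  show "(\<lambda>z\<in>Cx. g z) \<in> Cx \<rightarrow>\<^sub>E C" using assms(1) by auto
  fix z assume z: "z \<in> Cx"
  have "\<forall>\<^sub>F w in at z. diff_quot g z w = diff_quot (\<lambda>z\<in>Cx. g z) z w"
    using eventually_at_Cx[OF z] by eventually_elim (simp add: diff_quot_def z)
  then show "\<exists>l. cnv (diff_quot (\<lambda>z\<in>Cx. g z) z) l (at z)"
    using assms(2)[OF z] cnv_cong by blast
qed

lemma hol_cnv_at:
  assumes "f \<in> H" "z \<in> Cx"
  shows "cnv f (f z) (at z)"
proof -
  obtain l where l: "cnv (diff_quot f z) l (at z)" using holD[OF assms] by blast
  have "((\<lambda>w. w - z) \<longlongrightarrow> z - z) (at z)" by (intro tendsto_intros)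
  from cnv_add[OF cnv_scale[OF this l] cnv_const[OF hol_C[OF assms]]]
  have "cnv (\<lambda>w \<alpha>. (w - z) * diff_quot f z w \<alpha> + f z \<alpha>) (f z) (at z)" by simp
  moreover have "\<forall>\<^sub>F w in at z. (\<lambda>\<alpha>. (w - z) * diff_quot f z w \<alpha> + f z \<alpha>) = f w"
    unfolding eventually_at_filter by (intro always_eventually) (simp add: diff_quot_def fun_eq_iff mult.assoc[symmetric])
  ultimately show ?thesis by (rule cnv_cong[rotated])
qed

text \<open>Joint limits use \<open>nhds z\<close>, which does not exclude the point z itself; there
  the norm of the difference is 0.\<close>

lemma hol_cnv:
  assumes "f \<in> H" "z \<in> Cx"
  shows "cnv f (f z) (nhds z)"
  unfolding cnv_def
proof (intro conjI ballI hol_C[OF assms])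
  show "\<forall>\<^sub>F w in nhds z. f w \<in> C"
    using eventually_Cx[OF assms(2)] by eventually_elim (rule hol_C[OF assms(1)])
  fix w assume "w \<in> W"
  then show "((\<lambda>t. wnorm n w (\<lambda>\<alpha>. f t \<alpha> - f z \<alpha>)) \<longlongrightarrow> 0) (nhds z)"
    using cnv_tendsto[OF hol_cnv_at[OF assms]]
      tendsto_at_iff_tendsto_nhds[of "\<lambda>t. wnorm n w (\<lambda>\<alpha>. f t \<alpha> - f z \<alpha>)" z] by simp
qed

lemma hol_const: "a \<in> C \<Longrightarrow> (\<lambda>z\<in>Cx. a) \<in> H"
  using cnv_const[OF zero_C] by (intro holI) (auto simp: diff_quot_def[abs_def])

lemma hol_scale:
  assumes "h holomorphic_on Cx" "f \<in> H"
  shows "(\<lambda>z\<in>Cx. \<lambda>\<alpha>. h z * f z \<alpha>) \<in> H"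
proof (rule holI)
  fix z assume z: "z \<in> Cx"
  show "(\<lambda>\<alpha>. h z * f z \<alpha>) \<in> C" using assms z by (intro scale_C hol_C)
  obtain l where l: "cnv (diff_quot f z) l (at z)" using holD[OF assms(2) z] by blast
  have eq: "diff_quot (\<lambda>z \<alpha>. h z * f z \<alpha>) z =
      (\<lambda>w \<alpha>. inverse (w - z) * (h w - h z) * f w \<alpha> + h z * diff_quot f z w \<alpha>)"
    by (simp add: diff_quot_def fun_eq_iff algebra_simps)
  show "\<exists>l. cnv (diff_quot (\<lambda>z \<alpha>. h z * f z \<alpha>) z) l (at z)"
    unfolding eq
    using cnv_add[OF cnv_scale[OF holomorphic_diff_quot(1)[OF assms(1) z] hol_cnv_at[OF assms(2) z]]
        cnv_scale[OF tendsto_const l]] by blast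
qed

lemma hol_add:
  assumes "f \<in> H" "g \<in> H"
  shows "(\<lambda>z\<in>Cx. \<lambda>\<alpha>. f z \<alpha> + g z \<alpha>) \<in> H"
proof (rule holI)
  fix z assume z: "z \<in> Cx"
  show "(\<lambda>\<alpha>. f z \<alpha> + g z \<alpha>) \<in> C" using assms z by (intro add_C hol_C)
  obtain l where l: "cnv (diff_quot f z) l (at z)" using holD[OF assms(1) z] by blast
  obtain m where m: "cnv (diff_quot g z) m (at z)" using holD[OF assms(2) z] by blast
  have eq: "diff_quot (\<lambda>z \<alpha>. f z \<alpha> + g z \<alpha>) z = (\<lambda>w \<alpha>. diff_quot f z w \<alpha> + diff_quot g z w \<alpha>)"
    by (simp add: diff_quot_def fun_eq_iff algebra_simps)
  show "\<exists>l. cnv (diff_quot (\<lambda>z \<alpha>. f z \<alpha> + g z \<alpha>) z) l (at z)"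
    unfolding eq using cnv_add[OF l m] by blast
qed

lemma hol_uminus: "f \<in> H \<Longrightarrow> (\<lambda>z\<in>Cx. \<lambda>\<alpha>. - f z \<alpha>) \<in> H"
  using hol_scale[of "\<lambda>_. -1" f] by simp

lemma hol_diff:
  assumes "f \<in> H" "g \<in> H"
  shows "(\<lambda>z\<in>Cx. \<lambda>\<alpha>. f z \<alpha> - g z \<alpha>) \<in> H"
proof -
  have "(\<lambda>z\<in>Cx. \<lambda>\<alpha>. f z \<alpha> + (\<lambda>z\<in>Cx. \<lambda>\<alpha>. - g z \<alpha>) z \<alpha>) \<in> H"
    by (rule hol_add[OF assms(1) hol_uminus[OF assms(2)]])
  moreover have "(\<lambda>z\<in>Cx. \<lambda>\<alpha>. f z \<alpha> + (\<lambda>z\<in>Cx. \<lambda>\<alpha>. - g z \<alpha>) z \<alpha>) = (\<lambda>z\<in>Cx. \<lambda>\<alpha>. f z \<alpha> - g z \<alpha>)"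
    by (rule restrict_ext) simp
  ultimately show ?thesis by simp
qed

lemma hol_mult:
  assumes "f \<in> H" "g \<in> H"
  shows "(\<lambda>z\<in>Cx. series_mult (f z) (g z)) \<in> H"
proof (rule holI)
  fix z assume z: "z \<in> Cx"
  have fz: "f z \<in> C" and gz: "g z \<in> C" using assms z by (auto intro: hol_C)
  then show "series_mult (f z) (g z) \<in> C" by (rule mult_C)
  obtain l where l: "cnv (diff_quot f z) l (at z)" using holD[OF assms(1) z] by blast
  obtain m where m: "cnv (diff_quot g z) m (at z)" using holD[OF assms(2) z] by blast
  \<comment> \<open>The product rule, with the first term taken at \<open>g w\<close>; continuity of
    \<open>g\<close> supplies its limit.\<close>
  have eq: "diff_quot (\<lambda>z. series_mult (f z) (g z)) z =
      (\<lambda>w \<alpha>. series_mult (diff_quot f z w) (g w) \<alpha> + series_mult (f z) (diff_quot g z w) \<alpha>)"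
    unfolding diff_quot_def series_mult_scale_left series_mult_scale_right
      series_mult_diff_left series_mult_diff_right by (simp add: fun_eq_iff algebra_simps)
  show "\<exists>l. cnv (diff_quot (\<lambda>z. series_mult (f z) (g z)) z) l (at z)"
    unfolding eq
    using cnv_add[OF cnv_mult[OF l hol_cnv_at[OF assms(2) z]] cnv_mult[OF cnv_const[OF fz] m]]
    by blast
qed

text \<open>Makes coefficients admissible as scalars, so that a truncation is a finite combination
  of words over the holomorphic functions.\<close>

lemma hol_coeff:
  assumes "f \<in> H"
  shows "(\<lambda>z. f z \<alpha>) holomorphic_on Cx"
  unfolding holomorphic_on_def
proof
  fix z assume z: "z \<in> Cx"
  obtain l where "cnv (diff_quot f z) l (at z)" using holD[OF assms z] by blast
  from cnv_coeff[OF this, of \<alpha>]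
  have "((\<lambda>z. f z \<alpha>) has_field_derivative l \<alpha>) (at z)"
    by (simp add: has_field_derivative_iff diff_quot_def divide_inverse mult.commute)
  then show "(\<lambda>z. f z \<alpha>) field_differentiable at z within Cx"
    using field_differentiable_def field_differentiable_at_within by blast
qed

lemma A_sel [simp]:
  "carrier A = H" "mult A = (\<lambda>f g. \<lambda>z\<in>Cx. series_mult (f z) (g z))"
  "one A = (\<lambda>z\<in>Cx. monomial [])" "zero A = (\<lambda>z\<in>Cx. \<lambda>\<alpha>. 0)"
  "add A = (\<lambda>f g. \<lambda>z\<in>Cx. \<lambda>\<alpha>. f z \<alpha> + g z \<alpha>)"
  "smult A = (\<lambda>h f. \<lambda>z\<in>Cx. \<lambda>\<alpha>. h z * f z \<alpha>)"
  by (simp_all add: hol_alg_def)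

lemma hol_zero: "(\<lambda>z\<in>Cx. \<lambda>\<alpha>. 0) \<in> H"
  and hol_one: "(\<lambda>z\<in>Cx. monomial []) \<in> H"
  by (intro hol_const zero_C monomial_C words_Nil)+

lemma ring_A: "ring A"
proof (rule ringI)
  show "abelian_group A"
  proof (rule abelian_groupI)
    fix x assume "x \<in> carrier A"
    then show "\<exists>y\<in>carrier A. y \<oplus>\<^bsub>A\<^esub> x = \<zero>\<^bsub>A\<^esub>"
      using hol_uminus by (intro bexI[of _ "\<lambda>z\<in>Cx. \<lambda>\<alpha>. - x z \<alpha>"]) (auto intro!: restrict_ext)
  next
    fix x assume "x \<in> carrier A"
    then show "\<zero>\<^bsub>A\<^esub> \<oplus>\<^bsub>A\<^esub> x = x"
      using hol_restrict[of x] by (simp cong: restrict_cong)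
  qed (auto simp: hol_zero intro: hol_add intro!: restrict_ext)
  show "monoid A"
  proof (rule monoidI)
    fix x assume "x \<in> carrier A"
    then have x: "(\<lambda>z\<in>Cx. x z) = x" by (simp add: hol_restrict)
    show "\<one>\<^bsub>A\<^esub> \<otimes>\<^bsub>A\<^esub> x = x"
      by (subst (2) x[symmetric]) (simp add: series_mult_one_left cong: restrict_cong)
    show "x \<otimes>\<^bsub>A\<^esub> \<one>\<^bsub>A\<^esub> = x"
      by (subst (2) x[symmetric]) (simp add: series_mult_one_right cong: restrict_cong)
  qed (auto simp: hol_one series_mult_assoc intro: hol_mult intro!: restrict_ext)
qed (auto simp: series_mult_add_left series_mult_add_right intro!: restrict_ext)

lemma A_uminus:
  assumes "f \<in> H"
  shows "\<ominus>\<^bsub>A\<^esub> f = (\<lambda>z\<in>Cx. \<lambda>\<alpha>. - f z \<alpha>)"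
proof -
  interpret ring A by (rule ring_A)
  show ?thesis
    using assms hol_uminus[OF assms] by (intro minus_equality) (auto intro!: restrict_ext)
qed

lemma A_minus:
  assumes "f \<in> H" "g \<in> H"
  shows "f \<ominus>\<^bsub>A\<^esub> g = (\<lambda>z\<in>Cx. \<lambda>\<alpha>. f z \<alpha> - g z \<alpha>)"
  unfolding a_minus_def A_uminus[OF assms(2)] by (auto intro!: restrict_ext)

section \<open>The compact-open topology\<close>

lemma topo_A: "topo A = topology_generated_by
    {{f \<in> H. f ` K \<subseteq> U} | K U. compact K \<and> K \<subseteq> Cx \<and> openin (topo F) U}"
  by (simp add: hol_alg_def)

lemma Union_topo_A: "\<Union>{{f \<in> H. f ` K \<subseteq> U} | K U. compact K \<and> K \<subseteq> Cx \<and> openin (topo F) U} = H"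
proof (intro equalityI subsetI)
  fix f assume "f \<in> H"
  then show "f \<in> \<Union>{{f \<in> H. f ` K \<subseteq> U} | K U. compact K \<and> K \<subseteq> Cx \<and> openin (topo F) U}"
    by (intro UnionI[of "{f \<in> H. f ` {} \<subseteq> {}}"] CollectI exI[of _ "{}"]) simp_all
qed blast

lemma topspace_A [simp]: "topspace (topo A) = H"
  unfolding topo_A topology_generated_by_topspace by (rule Union_topo_A)

text \<open>
  Continuous convergence, that is \<open>f N y\<close> tending to \<open>g z\<close> jointly in \<open>N \<rightarrow> \<infinity>\<close> and \<open>y \<rightarrow> z\<close>, implies
  convergence in the compact-open topology and is compatible with products.
\<close>

lemma limitin_A:
  assumes f: "\<And>N. f N \<in> H" and g: "g \<in> H"
    and lim: "\<And>z. z \<in> Cx \<Longrightarrow> cnv (\<lambda>(N, y). f N y) (g z) (sequentially \<times>\<^sub>F nhds z)"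
  shows "limitin (topo A) f g sequentially"
  unfolding topo_A
proof (rule limitin_topology_generated_byI)
  show "g \<in> \<Union>{{f \<in> H. f ` K \<subseteq> U} | K U. compact K \<and> K \<subseteq> Cx \<and> openin (topo F) U}"
    unfolding Union_topo_A by (rule g)
  fix S assume "S \<in> {{f \<in> H. f ` K \<subseteq> U} | K U. compact K \<and> K \<subseteq> Cx \<and> openin (topo F) U}" "g \<in> S"
  then obtain K U where S: "S = {f \<in> H. f ` K \<subseteq> U}" and K: "compact K" "K \<subseteq> Cx"
    and U: "openin (topo F) U" and gK: "g ` K \<subseteq> U" by auto
  \<comment> \<open>Joint convergence gives each point of \<open>K\<close> a threshold and a
    neighbourhood; compactness leaves finitely many thresholds.\<close>
  have "\<exists>N0 V. open V \<and> z \<in> V \<and> (\<forall>N\<ge>N0. \<forall>y\<in>V. f N y \<in> U)" if z: "z \<in> K" for z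
  proof -
    have "limitin (topo F) (\<lambda>(N, y). f N y) (g z) (sequentially \<times>\<^sub>F nhds z)"
      using lim z K by (auto simp: limitin_F)
    then have "\<forall>\<^sub>F (N, y) in sequentially \<times>\<^sub>F nhds z. f N y \<in> U"
      using U gK z unfolding limitin_def by (auto simp: case_prod_unfold)
    then obtain P Q where "eventually P sequentially" "eventually Q (nhds z)"
      and PQ: "\<And>N y. P N \<Longrightarrow> Q y \<Longrightarrow> f N y \<in> U"
      unfolding eventually_prod_filter by auto
    then show ?thesis unfolding eventually_sequentially eventually_nhds by metis
  qed
  then obtain N0 V where V: "\<And>z. z \<in> K \<Longrightarrow> open (V z)" "\<And>z. z \<in> K \<Longrightarrow> z \<in> V z"
    "\<And>z N y. z \<in> K \<Longrightarrow> N \<ge> N0 z \<Longrightarrow> y \<in> V z \<Longrightarrow> f N y \<in> U"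
    by metis
  have "K \<subseteq> (\<Union>z\<in>K. V z)" using V(2) by blast
  then obtain D where D: "D \<subseteq> K" "finite D" "K \<subseteq> (\<Union>z\<in>D. V z)"
    using compactE_image[OF K(1), of K V] V(1) by metis
  have "\<forall>\<^sub>F N in sequentially. \<forall>z\<in>D. N \<ge> N0 z"
    using D(2) by (intro eventually_ball_finite) (auto simp: eventually_ge_at_top)
  then show "\<forall>\<^sub>F N in sequentially. f N \<in> S"
  proof eventually_elim
    case (elim N)
    have "f N y \<in> U" if "y \<in> K" for y
      using that D V(3) elim by blast
    then show ?case using f S by auto
  qed
qed

section \<open>The closed ideal generated by the relators\<close>

abbreviation "I \<equiv> def_ideal n A"

lemma monomial_word_C: "i \<in> {1..n} \<Longrightarrow> j \<in> {1..n} \<Longrightarrow> monomial [i, j] \<in> C"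
  by (rule monomial_C) (auto simp: words_def)

lemma relator_hol:
  assumes "1 \<le> i" "i < j" "j \<le> n"
  shows "relator i j \<in> H"
proof -
  have "(\<lambda>z\<in>Cx. monomial [i, j]) \<in> H" "(\<lambda>z\<in>Cx. monomial [j, i]) \<in> H"
    using assms by (auto intro!: hol_const monomial_word_C)
  from hol_diff[OF this(1) hol_scale[OF holomorphic_on_ident this(2)]]
  show ?thesis by (simp add: relator_def cong: restrict_cong)
qed

lemma relator_eq:
  assumes "1 \<le> i" "i < j" "j \<le> n"
  shows "(zeta i \<otimes>\<^bsub>A\<^esub> zeta j) \<ominus>\<^bsub>A\<^esub> (coord \<odot>\<^bsub>A\<^esub> (zeta j \<otimes>\<^bsub>A\<^esub> zeta i)) = relator i j"
proof -
  have z: "zeta i \<otimes>\<^bsub>A\<^esub> zeta j = (\<lambda>z\<in>Cx. monomial [i, j])" for i j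
    by (simp add: zeta_def series_mult_monomial cong: restrict_cong)
  have 1: "(\<lambda>z\<in>Cx. monomial [i, j]) \<in> H"
    and 2: "(\<lambda>z\<in>Cx. \<lambda>\<alpha>. z * (\<lambda>z\<in>Cx. monomial [j, i]) z \<alpha>) \<in> H"
    using assms by (intro hol_scale hol_const monomial_word_C holomorphic_on_ident; simp)+
  have "coord \<odot>\<^bsub>A\<^esub> (\<lambda>z\<in>Cx. monomial [j, i]) = (\<lambda>z\<in>Cx. \<lambda>\<alpha>. z * (\<lambda>z\<in>Cx. monomial [j, i]) z \<alpha>)"
    by (simp add: coord_def cong: restrict_cong)
  then show ?thesis
    unfolding z using A_minus[OF 1 2] by (simp add: relator_def cong: restrict_cong)
qed

lemma I_eq: "I = \<Inter>{J. ideal J A \<and> closedin (topo A) J \<and>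
    (\<forall>i j. 1 \<le> i \<longrightarrow> i < j \<longrightarrow> j \<le> n \<longrightarrow> relator i j \<in> J)}"
proof -
  have "{(zeta i \<otimes>\<^bsub>A\<^esub> zeta j) \<ominus>\<^bsub>A\<^esub> (coord \<odot>\<^bsub>A\<^esub> (zeta j \<otimes>\<^bsub>A\<^esub> zeta i)) | i j.
        1 \<le> i \<and> i < j \<and> j \<le> n} = {relator i j | i j. 1 \<le> i \<and> i < j \<and> j \<le> n}"
    using relator_eq by (metis (no_types, opaque_lifting))
  then show ?thesis unfolding def_ideal_def closed_ideal_gen_def
    by (intro arg_cong[where f = Inter] Collect_cong) auto
qed

lemma I_least:
  assumes "ideal J A" "closedin (topo A) J"
    "\<And>i j. 1 \<le> i \<Longrightarrow> i < j \<Longrightarrow> j \<le> n \<Longrightarrow> relator i j \<in> J"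
  shows "I \<subseteq> J"
  unfolding I_eq using assms by blast

text \<open>Shows that the family intersected in \<open>I_eq\<close> is nonempty, so that its
  intersection is a closed ideal inside the carrier.\<close>

lemma carrier_admissible:
  "H \<in> {J. ideal J A \<and> closedin (topo A) J \<and>
    (\<forall>i j. 1 \<le> i \<longrightarrow> i < j \<longrightarrow> j \<le> n \<longrightarrow> relator i j \<in> J)}"
  using ring.oneideal[OF ring_A] closedin_topspace[of "topo A"] relator_hol by auto

lemma I_ideal: "ideal I A"
  unfolding I_eq using carrier_admissible by (intro ring.i_Intersect[OF ring_A]) blast+

lemma I_closed: "closedin (topo A) I"
  unfolding I_eq using carrier_admissible by (intro closedin_Inter) blast+

lemma relator_I: "1 \<le> i \<Longrightarrow> i < j \<Longrightarrow> j \<le> n \<Longrightarrow> relator i j \<in> I"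
  unfolding I_eq by blast

lemma I_hol: "f \<in> I \<Longrightarrow> f \<in> H"
  using additive_subgroup.a_subset[OF ideal.axioms(1)[OF I_ideal]] by auto

lemma I_add: "f \<in> I \<Longrightarrow> g \<in> I \<Longrightarrow> (\<lambda>z\<in>Cx. \<lambda>\<alpha>. f z \<alpha> + g z \<alpha>) \<in> I"
  using additive_subgroup.a_closed[OF ideal.axioms(1)[OF I_ideal]] by simp

lemma I_zero: "(\<lambda>z\<in>Cx. \<lambda>\<alpha>. 0) \<in> I"
  using additive_subgroup.zero_closed[OF ideal.axioms(1)[OF I_ideal]] by simp

lemma I_mult_left: "f \<in> I \<Longrightarrow> g \<in> H \<Longrightarrow> (\<lambda>z\<in>Cx. series_mult (g z) (f z)) \<in> I"
  using ideal.I_l_closed[OF I_ideal] by simp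

lemma I_mult_right: "f \<in> I \<Longrightarrow> g \<in> H \<Longrightarrow> (\<lambda>z\<in>Cx. series_mult (f z) (g z)) \<in> I"
  using ideal.I_r_closed[OF I_ideal] by simp

text \<open>An \<open>ideal\<close> is only a ring ideal; scalars act on it because h f is the
  product of h 1 and f.\<close>

lemma I_scale:
  assumes "f \<in> I" "h holomorphic_on Cx"
  shows "(\<lambda>z\<in>Cx. \<lambda>\<alpha>. h z * f z \<alpha>) \<in> I"
proof -
  have "(\<lambda>z\<in>Cx. series_mult ((\<lambda>z\<in>Cx. \<lambda>\<alpha>. h z * (\<lambda>z\<in>Cx. monomial []) z \<alpha>) z) (f z)) \<in> I"
    by (intro I_mult_left hol_scale assms hol_one)
  then show ?thesis
    by (simp add: series_mult_scale_left series_mult_one_left cong: restrict_cong)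
qed

lemma I_uminus: "f \<in> I \<Longrightarrow> (\<lambda>z\<in>Cx. \<lambda>\<alpha>. - f z \<alpha>) \<in> I"
  using I_scale[of f "\<lambda>_. -1"] by simp

lemma I_diff:
  assumes "f \<in> I" "g \<in> I"
  shows "(\<lambda>z\<in>Cx. \<lambda>\<alpha>. f z \<alpha> - g z \<alpha>) \<in> I"
  using I_add[OF assms(1) I_uminus[OF assms(2)]] by (simp cong: restrict_cong)

text \<open>The form in which both density arguments, \<open>normalize_cong_I\<close> and
  \<open>normalize_mult\<close>, use that \<open>I\<close> is closed.\<close>

lemma I_limit:
  assumes "\<And>N. f N \<in> I" "g \<in> H"
    and "\<And>z. z \<in> Cx \<Longrightarrow> cnv (\<lambda>(N, y). f N y) (g z) (sequentially \<times>\<^sub>F nhds z)"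
  shows "g \<in> I"
proof -
  have "limitin (topo A) f g sequentially"
    using assms I_hol by (intro limitin_A) auto
  then show ?thesis
    using limitin_closedin[OF _ I_closed] assms(1) by (metis always_eventually sequentially_bot)
qed

lemma idealI':
  assumes "J \<subseteq> H" "(\<lambda>z\<in>Cx. \<lambda>\<alpha>. 0) \<in> J"
    and "\<And>f g. f \<in> J \<Longrightarrow> g \<in> J \<Longrightarrow> (\<lambda>z\<in>Cx. \<lambda>\<alpha>. f z \<alpha> + g z \<alpha>) \<in> J"
    and "\<And>f. f \<in> J \<Longrightarrow> (\<lambda>z\<in>Cx. \<lambda>\<alpha>. - f z \<alpha>) \<in> J"
    and "\<And>f g. f \<in> J \<Longrightarrow> g \<in> H \<Longrightarrow> (\<lambda>z\<in>Cx. series_mult (g z) (f z)) \<in> J"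
    and "\<And>f g. f \<in> J \<Longrightarrow> g \<in> H \<Longrightarrow> (\<lambda>z\<in>Cx. series_mult (f z) (g z)) \<in> J"
  shows "ideal J A"
proof (rule idealI[OF ring_A])
  interpret ring A by (rule ring_A)
  show "subgroup J (add_monoid A)"
  proof (rule group.subgroupI[OF add.is_group])
    fix f assume "f \<in> J"
    moreover from this have "f \<in> H" using assms(1) by blast
    ultimately show "inv\<^bsub>add_monoid A\<^esub> f \<in> J"
      using assms(4)[of f] A_uminus[of f] by (simp add: a_inv_def)
  qed (use assms in auto)
qed (use assms in auto)

end

definition hmap :: "(series \<Rightarrow> series) \<Rightarrow> (complex \<Rightarrow> series) \<Rightarrow> complex \<Rightarrow> series" where
  "hmap T f = (\<lambda>z\<in>Cx. T (f z))"

lemma hmap_apply [simp]: "z \<in> Cx \<Longrightarrow> hmap T f z = T (f z)"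
  by (simp add: hmap_def)

context weight_map
begin

text \<open>By linearity \<open>T\<close> commutes with difference quotients, by continuity with
  their limits.\<close>

lemma hmap_hol:
  assumes "f \<in> src.H"
  shows "hmap T f \<in> tgt.H"
  unfolding hmap_def
proof (rule tgt.holI)
  fix z assume z: "z \<in> Cx"
  show "T (f z) \<in> tgt.C" using assms z by (intro T_C src.hol_C)
  obtain l where "src.cnv (diff_quot f z) l (at z)" using src.holD[OF assms z] by blast
  then have "tgt.cnv (\<lambda>w. T (diff_quot f z w)) (T l) (at z)" by (rule cnv_map)
  moreover have "(\<lambda>w. T (diff_quot f z w)) = diff_quot (\<lambda>z. T (f z)) z"
    by (simp add: diff_quot_def[abs_def] T_scale T_diff)
  ultimately show "\<exists>l. tgt.cnv (diff_quot (\<lambda>z. T (f z)) z) l (at z)" by auto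
qed

text \<open>The preimage of the functions mapping K into U consists of the functions mapping K into
  the open preimage of U under \<open>T\<close>.\<close>

lemma continuous_map_hmap: "continuous_map (topo src.A) (topo tgt.A) (hmap T)"
  unfolding tgt.topo_A
proof (rule continuous_on_generated_topo)
  fix S assume "S \<in> {{f \<in> tgt.H. f ` K \<subseteq> U} | K U. compact K \<and> K \<subseteq> Cx \<and> openin (topo tgt.F) U}"
  then obtain K U where S: "S = {f \<in> tgt.H. f ` K \<subseteq> U}" and K: "compact K" "K \<subseteq> Cx"
    and U: "openin (topo tgt.F) U" by blast
  let ?U = "{a \<in> topspace (topo src.F). T a \<in> U}"
  have "openin (topo src.F) ?U"
    using continuous_map_T U by (rule openin_continuous_map_preimage)
  then have "openin (topo src.A) {f \<in> src.H. f ` K \<subseteq> ?U}"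
    unfolding src.topo_A using K by (intro topology_generated_by_Basis) blast
  also have "{f \<in> src.H. f ` K \<subseteq> ?U} = hmap T -` S \<inter> topspace (topo src.A)"
  proof (intro equalityI subsetI)
    fix f assume f: "f \<in> {f \<in> src.H. f ` K \<subseteq> ?U}"
    have "hmap T f y \<in> U" if "y \<in> K" for y
    proof -
      have "y \<in> Cx" "f y \<in> ?U" using f K(2) that by blast+
      then show ?thesis by simp
    qed
    then show "f \<in> hmap T -` S \<inter> topspace (topo src.A)"
      using f hmap_hol[of f] by (auto simp: S)
  next
    fix f assume "f \<in> hmap T -` S \<inter> topspace (topo src.A)"
    then have f: "f \<in> src.H" and im: "hmap T f ` K \<subseteq> U" by (auto simp: S)
    have "f y \<in> ?U" if "y \<in> K" for y
    proof -
      have "y \<in> Cx" using that K by blast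
      moreover have "hmap T f y \<in> U" using im that by blast
      ultimately show ?thesis using src.hol_C[OF f] by simp
    qed
    then show "f \<in> {f \<in> src.H. f ` K \<subseteq> ?U}" using f by blast
  qed
  finally show "openin (topo src.A) (hmap T -` S \<inter> topspace (topo src.A))" .
next
  show "hmap T ` topspace (topo src.A) \<subseteq>
      \<Union>{{f \<in> tgt.H. f ` K \<subseteq> U} | K U. compact K \<and> K \<subseteq> Cx \<and> openin (topo tgt.F) U}"
    unfolding tgt.Union_topo_A using hmap_hol by auto
qed

end

section \<open>Reordering words modulo the relators\<close>

definition zmon :: "nat \<Rightarrow> nat list \<Rightarrow> complex \<Rightarrow> series" where
  "zmon k \<alpha> z = (\<lambda>\<gamma>. z ^ k * monomial \<alpha> \<gamma>)"

text \<open>The linear extension of zeta_alpha -> zeta_(g alpha), sending words outside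
  \<open>Q\<close> to 0. If \<open>g\<close> preserves length, the fibres are finite, as there are
  finitely many words of a given length.\<close>

definition push :: "nat list set \<Rightarrow> (nat list \<Rightarrow> nat list) \<Rightarrow> series \<Rightarrow> series" where
  "push Q g a = (\<lambda>\<gamma>. \<Sum>\<alpha> | \<alpha> \<in> Q \<and> g \<alpha> = \<gamma>. a \<alpha>)"

definition short_words :: "nat \<Rightarrow> nat \<Rightarrow> nat list set" where
  "short_words n N = {\<alpha> \<in> words n. length \<alpha> \<le> N}"

abbreviation trunc :: "nat \<Rightarrow> nat \<Rightarrow> series \<Rightarrow> series" where
  "trunc n N \<equiv> push (short_words n N) (\<lambda>\<alpha>. \<alpha>)"

lemma finite_short_words: "finite (short_words n N)"
  unfolding short_words_def by (rule finite_words_length)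

lemma trunc_apply: "trunc n N a \<alpha> = (if \<alpha> \<in> short_words n N then a \<alpha> else 0)"
proof -
  have "{\<beta> \<in> short_words n N. \<beta> = \<alpha>} = (if \<alpha> \<in> short_words n N then {\<alpha>} else {})" by auto
  then show ?thesis by (simp add: push_def)
qed

lemma finite_fibre:
  assumes "Q \<subseteq> words n" "\<And>\<alpha>. \<alpha> \<in> Q \<Longrightarrow> length (g \<alpha>) = length \<alpha>"
  shows "finite {\<alpha> \<in> Q. g \<alpha> = \<gamma>}"
  by (rule finite_subset[OF _ finite_words_length[of n "length \<gamma>"]]) (use assms in force)

text \<open>The fibres of \<open>g\<close> are disjoint, so the norm of the image is at most a sum
  over \<open>Q\<close> with the weights v (g alpha). Continuity becomes a comparison of weights,
  word by word.\<close>

lemma weight_map_push: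
  assumes "weight_family W" "weight_family V" and Q: "Q \<subseteq> words n"
    and g: "\<And>\<alpha>. \<alpha> \<in> Q \<Longrightarrow> g \<alpha> \<in> words n" "\<And>\<alpha>. \<alpha> \<in> Q \<Longrightarrow> length (g \<alpha>) = length \<alpha>"
    and bound: "\<And>v. v \<in> V \<Longrightarrow> \<exists>w\<in>W. \<exists>c. \<forall>\<alpha>\<in>Q. v (g \<alpha>) \<le> c * w \<alpha>"
  shows "weight_map n W V (push Q g)"
proof -
  interpret src: weight_family n W by fact
  interpret tgt: weight_family n V by fact
  have fib: "finite {\<alpha> \<in> Q. g \<alpha> = \<gamma>}" for \<gamma> by (rule finite_fibre[OF Q g(2)])
  have main: "\<exists>w\<in>W. \<exists>c. \<forall>a\<in>src.C. \<forall>S. finite S \<longrightarrow> S \<subseteq> words n \<longrightarrow>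
      (\<Sum>\<gamma>\<in>S. cmod (push Q g a \<gamma>) * v \<gamma>) \<le> c * wnorm n w a" if v: "v \<in> V" for v
  proof -
    obtain w c where w: "w \<in> W" and c: "\<And>\<alpha>. \<alpha> \<in> Q \<Longrightarrow> v (g \<alpha>) \<le> c * w \<alpha>"
      using bound[OF v] by blast
    \<comment> \<open>\<open>c\<close> can be negative when \<open>Q\<close> is empty.\<close>
    define d where "d = max c 0"
    have d: "v (g \<alpha>) \<le> d * w \<alpha>" if "\<alpha> \<in> Q" for \<alpha>
      using order_trans[OF c[OF that] mult_right_mono[OF _ src.W_nonneg[OF w]]] by (simp add: d_def)
    have d0: "0 \<le> d" by (simp add: d_def)
    have "(\<Sum>\<gamma>\<in>S. cmod (push Q g a \<gamma>) * v \<gamma>) \<le> d * wnorm n w a"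
      if a: "a \<in> src.C" and S: "finite S" "S \<subseteq> words n" for a S
    proof -
      let ?U = "\<Union>\<gamma>\<in>S. {\<alpha> \<in> Q. g \<alpha> = \<gamma>}"
      have "(\<Sum>\<gamma>\<in>S. cmod (push Q g a \<gamma>) * v \<gamma>)
          \<le> (\<Sum>\<gamma>\<in>S. \<Sum>\<alpha> | \<alpha> \<in> Q \<and> g \<alpha> = \<gamma>. cmod (a \<alpha>) * v (g \<alpha>))"
      proof (rule sum_mono)
        fix \<gamma>
        have "cmod (push Q g a \<gamma>) * v \<gamma> \<le> (\<Sum>\<alpha> | \<alpha> \<in> Q \<and> g \<alpha> = \<gamma>. cmod (a \<alpha>)) * v \<gamma>"
          unfolding push_def by (intro mult_right_mono norm_sum tgt.W_nonneg v)
        also have "\<dots> = (\<Sum>\<alpha> | \<alpha> \<in> Q \<and> g \<alpha> = \<gamma>. cmod (a \<alpha>) * v (g \<alpha>))"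
          by (simp add: sum_distrib_right)
        finally show "cmod (push Q g a \<gamma>) * v \<gamma>
            \<le> (\<Sum>\<alpha> | \<alpha> \<in> Q \<and> g \<alpha> = \<gamma>. cmod (a \<alpha>) * v (g \<alpha>))" .
      qed
      also have "\<dots> = (\<Sum>\<alpha>\<in>?U. cmod (a \<alpha>) * v (g \<alpha>))"
        using S(1) fib by (intro sum.UNION_disjoint[symmetric]) auto
      also have "\<dots> \<le> (\<Sum>\<alpha>\<in>?U. cmod (a \<alpha>) * (d * w \<alpha>))"
        by (intro sum_mono mult_left_mono d) auto
      also have "\<dots> = d * (\<Sum>\<alpha>\<in>?U. cmod (a \<alpha>) * w \<alpha>)"
        by (simp add: sum_distrib_left ac_simps)
      also have "\<dots> \<le> d * wnorm n w a"
        using S(1) fib Q by (intro mult_left_mono d0 src.sum_le_wnorm a w finite_UN_I) auto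
      finally show ?thesis .
    qed
    then show ?thesis using w by blast
  qed
  have C: "push Q g a \<in> tgt.C" if a: "a \<in> src.C" for a
  proof (rule tgt.CI)
    fix \<gamma> assume "\<gamma> \<notin> words n"
    then have e: "{\<alpha> \<in> Q. g \<alpha> = \<gamma>} = {}" using g(1) by blast
    show "push Q g a \<gamma> = 0" unfolding push_def e by (rule sum.empty)
  qed (use main a in meson)
  show ?thesis
  proof unfold_locales
    fix a assume "a \<in> src.C"
    then show "push Q g a \<in> tgt.C" by (rule C)
  next
    fix v assume v: "v \<in> V"
    then show "\<exists>w\<in>W. \<exists>c. \<forall>a\<in>src.C. wnorm n v (push Q g a) \<le> c * wnorm n w a"
      using main[OF v] C tgt.wnorm_leI[OF _ v] by meson
  qed (simp_all add: push_def sum_subtractf sum_distrib_left)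
qed

text \<open>On finitely many words any two weights are comparable, the sum of the quotients bounding
  their maximum. So truncation is continuous even from the larger algebra into the smaller
  one.\<close>

lemma weight_map_trunc:
  assumes "weight_family W" "weight_family V"
  shows "weight_map n W V (trunc n N)"
proof (rule weight_map_push[OF assms])
  interpret src: weight_family n W by fact
  interpret tgt: weight_family n V by fact
  fix v assume v: "v \<in> V"
  obtain w where w: "w \<in> W" using src.W_nonempty by blast
  have "v \<alpha> \<le> (\<Sum>\<beta>\<in>short_words n N. v \<beta> / w \<beta>) * w \<alpha>" if "\<alpha> \<in> short_words n N" for \<alpha>
  proof -
    have "v \<alpha> / w \<alpha> \<le> (\<Sum>\<beta>\<in>short_words n N. v \<beta> / w \<beta>)"
      using that finite_short_words src.W_nonneg[OF w] tgt.W_nonneg[OF v]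
      by (intro member_le_sum) auto
    then show ?thesis using src.W_pos[OF w] by (simp add: pos_divide_le_eq)
  qed
  then show "\<exists>w\<in>W. \<exists>c. \<forall>\<alpha>\<in>short_words n N. v \<alpha> \<le> c * w \<alpha>" using w by blast
qed (auto simp: short_words_def)

context weight_family
begin

text \<open>Restricting inside the definition allows representatives with any value at 0.\<close>

definition cong_I :: "(complex \<Rightarrow> series) \<Rightarrow> (complex \<Rightarrow> series) \<Rightarrow> bool" where
  "cong_I f g \<longleftrightarrow> (\<lambda>z\<in>Cx. \<lambda>\<alpha>. f z \<alpha> - g z \<alpha>) \<in> I"

lemma cong_I_refl: "cong_I f f"
  using I_zero by (simp add: cong_I_def)

lemma cong_I_sym: "cong_I f g \<Longrightarrow> cong_I g f"
  unfolding cong_I_def by (drule I_uminus) (simp cong: restrict_cong)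

lemma cong_I_trans: "cong_I f g \<Longrightarrow> cong_I g h \<Longrightarrow> cong_I f h"
  unfolding cong_I_def by (drule (1) I_add) (simp cong: restrict_cong)

lemma cong_I_scale:
  "cong_I f g \<Longrightarrow> h holomorphic_on Cx \<Longrightarrow> cong_I (\<lambda>z \<alpha>. h z * f z \<alpha>) (\<lambda>z \<alpha>. h z * g z \<alpha>)"
  unfolding cong_I_def by (drule (1) I_scale) (simp add: right_diff_distrib cong: restrict_cong)

lemma cong_I_mult_left:
  "cong_I f g \<Longrightarrow> h \<in> H \<Longrightarrow>
    cong_I (\<lambda>z. series_mult (h z) (f z)) (\<lambda>z. series_mult (h z) (g z))"
  unfolding cong_I_def
  by (drule (1) I_mult_left) (simp add: series_mult_diff_right cong: restrict_cong)

lemma cong_I_mult_right: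
  "cong_I f g \<Longrightarrow> h \<in> H \<Longrightarrow>
    cong_I (\<lambda>z. series_mult (f z) (h z)) (\<lambda>z. series_mult (g z) (h z))"
  unfolding cong_I_def
  by (drule (1) I_mult_right) (simp add: series_mult_diff_left cong: restrict_cong)

lemma cong_I_cong:
  "(\<And>z. z \<in> Cx \<Longrightarrow> f z = f' z) \<Longrightarrow> (\<And>z. z \<in> Cx \<Longrightarrow> g z = g' z) \<Longrightarrow> cong_I f g \<Longrightarrow> cong_I f' g'"
  unfolding cong_I_def by (simp cong: restrict_cong)

lemma zmon_Cons:
  assumes "cong_I (zmon k \<alpha>) (zmon l \<beta>)" "x \<in> {1..n}"
  shows "cong_I (zmon k (x # \<alpha>)) (zmon l (x # \<beta>))"
proof -
  have "(\<lambda>z\<in>Cx. monomial [x]) \<in> H"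
    using assms(2) by (intro hol_const monomial_C) (auto simp: words_def)
  from cong_I_mult_left[OF assms(1) this] show ?thesis
    by (rule cong_I_cong[rotated -1])
      (simp_all add: zmon_def[abs_def] series_mult_scale_right series_mult_monomial)
qed

lemma zmon_power:
  assumes "cong_I (zmon k \<alpha>) (zmon l \<beta>)"
  shows "cong_I (zmon (m + k) \<alpha>) (zmon (m + l) \<beta>)"
  using cong_I_scale[OF assms, of "\<lambda>z. z ^ m"]
  by (simp add: zmon_def[abs_def] power_add mult.assoc holomorphic_on_power holomorphic_on_ident)

lemma zmon_swap:
  assumes "1 \<le> y" "y < x" "x \<le> n" "\<alpha> \<in> words n"
  shows "cong_I (zmon 0 (y # x # \<alpha>)) (zmon 1 (x # y # \<alpha>))"
proof -
  have "cong_I (zmon 0 [y, x]) (zmon 1 [x, y])"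
    using relator_I[OF assms(1-3)] unfolding cong_I_def relator_def
    by (simp add: zmon_def)
  moreover have "(\<lambda>z\<in>Cx. monomial \<alpha>) \<in> H"
    using assms(4) by (intro hol_const monomial_C)
  ultimately have "cong_I (\<lambda>z. series_mult (zmon 0 [y, x] z) ((\<lambda>z\<in>Cx. monomial \<alpha>) z))
      (\<lambda>z. series_mult (zmon 1 [x, y] z) ((\<lambda>z\<in>Cx. monomial \<alpha>) z))"
    by (rule cong_I_mult_right)
  then show ?thesis
    by (rule cong_I_cong[rotated -1])
      (simp_all add: zmon_def[abs_def] series_mult_scale_left series_mult_monomial)
qed

text \<open>The letter \<open>x\<close> moves right past the smaller letters, and each swap uses up
  one factor z. Since the list is sorted, no smaller letter remains where \<open>insort\<close>
  stops.\<close>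

lemma zmon_insort:
  "sorted \<alpha> \<Longrightarrow> x # \<alpha> \<in> words n \<Longrightarrow>
    cong_I (zmon (length (filter (\<lambda>y. y < x) \<alpha>)) (x # \<alpha>)) (zmon 0 (insort x \<alpha>))"
proof (induction \<alpha>)
  case Nil
  then show ?case by (simp add: cong_I_refl)
next
  case (Cons y \<alpha>)
  show ?case
  proof (cases "x \<le> y")
    case True
    then have "filter (\<lambda>u. u < x) (y # \<alpha>) = []"
      using Cons.prems(1) by (auto simp: filter_empty_conv)
    then show ?thesis using True by (simp add: cong_I_refl)
  next
    case False
    let ?k = "length (filter (\<lambda>y. y < x) \<alpha>)"
    have w: "1 \<le> y" "y < x" "x \<le> n" "\<alpha> \<in> words n" "x # \<alpha> \<in> words n" "y \<in> {1..n}"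
      using Cons.prems(2) False by (auto simp: words_def)
    have "cong_I (zmon (?k + 1) (x # y # \<alpha>)) (zmon (?k + 0) (y # x # \<alpha>))"
      by (rule zmon_power[OF cong_I_sym[OF zmon_swap[OF w(1-4)]]])
    moreover have "cong_I (zmon (?k + 0) (y # x # \<alpha>)) (zmon 0 (y # insort x \<alpha>))"
      using zmon_Cons[OF Cons.IH w(6)] Cons.prems(1) w(5) by simp
    ultimately show ?thesis using cong_I_trans False by fastforce
  qed
qed

text \<open>Insertion sort follows the recursion of \<open>inversions\<close>: the head costs as
  many factors as there are smaller letters in the tail, a number that does not change when the tail
  is sorted.\<close>

lemma zmon_sort:
  "\<alpha> \<in> words n \<Longrightarrow> cong_I (zmon (inversions \<alpha>) \<alpha>) (zmon 0 (sort \<alpha>))"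
proof (induction \<alpha>)
  case Nil
  then show ?case by (simp add: cong_I_refl)
next
  case (Cons x \<alpha>)
  let ?k = "length (filter (\<lambda>y. y < x) \<alpha>)"
  have w: "\<alpha> \<in> words n" "x \<in> {1..n}" "x # sort \<alpha> \<in> words n"
    using Cons.prems by (auto simp: words_def)
  have k: "?k = length (filter (\<lambda>y. y < x) (sort \<alpha>))"
    by (metis mset_filter mset_sort size_mset)
  have "cong_I (zmon (?k + inversions \<alpha>) (x # \<alpha>)) (zmon (?k + 0) (x # sort \<alpha>))"
    by (rule zmon_power[OF zmon_Cons[OF Cons.IH[OF w(1)] w(2)]])
  moreover have "cong_I (zmon ?k (x # sort \<alpha>)) (zmon 0 (insort x (sort \<alpha>)))"
    unfolding k using w(3) by (intro zmon_insort) auto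
  ultimately show ?case using cong_I_trans by simp
qed

text \<open>
  A word with an ascending pair of neighbours is \<open>z\<close> times the word with this pair swapped, which
  has one inversion more. So \<open>z ^ inversions \<alpha>\<close> times the word \<open>\<alpha>\<close> depends on the letters only; the
  factor can be cancelled because \<open>z\<close> is invertible on \<^const>\<open>Cx\<close>.
\<close>

lemma monomial_cong_I:
  assumes "\<alpha> \<in> words n" "mset \<alpha> = mset \<beta>" "inversions \<alpha> = inversions \<beta>" "h holomorphic_on Cx"
  shows "(\<lambda>z\<in>Cx. \<lambda>\<gamma>. h z * (monomial \<alpha> \<gamma> - monomial \<beta> \<gamma>)) \<in> I"
proof -
  let ?N = "inversions \<beta>"
  have "\<beta> \<in> words n" using assms(1) words_cong_mset[OF assms(2)] by blast
  moreover have "sort \<alpha> = sort \<beta>" using assms(2) by (metis mset_sort properties_for_sort sorted_sort)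
  ultimately have "cong_I (zmon ?N \<alpha>) (zmon ?N \<beta>)"
    using zmon_sort[OF assms(1)] zmon_sort[of \<beta>] assms(3) cong_I_sym cong_I_trans by metis
  moreover have "(\<lambda>z. h z * inverse (z ^ ?N)) holomorphic_on Cx"
    using assms(4) by (intro holomorphic_intros) (auto simp: Cx_def)
  ultimately have "cong_I (\<lambda>z \<gamma>. h z * inverse (z ^ ?N) * zmon ?N \<alpha> z \<gamma>)
      (\<lambda>z \<gamma>. h z * inverse (z ^ ?N) * zmon ?N \<beta> z \<gamma>)"
    by (rule cong_I_scale)
  then have "cong_I (\<lambda>z \<gamma>. h z * monomial \<alpha> \<gamma>) (\<lambda>z \<gamma>. h z * monomial \<beta> \<gamma>)"
    by (rule cong_I_cong[rotated -1]) (auto simp: zmon_def Cx_def fun_eq_iff)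
  then show ?thesis by (simp add: cong_I_def right_diff_distrib cong: restrict_cong)
qed

lemma I_sum:
  assumes "finite S" "\<And>\<alpha>. \<alpha> \<in> S \<Longrightarrow> (\<lambda>z\<in>Cx. f \<alpha> z) \<in> I"
  shows "(\<lambda>z\<in>Cx. \<lambda>\<gamma>. \<Sum>\<alpha>\<in>S. f \<alpha> z \<gamma>) \<in> I"
  using assms
proof (induction S rule: finite_induct)
  case empty
  show ?case unfolding sum.empty by (rule I_zero)
next
  case (insert \<alpha> S)
  have "(\<lambda>z\<in>Cx. \<lambda>\<gamma>. \<Sum>\<alpha>\<in>insert \<alpha> S. f \<alpha> z \<gamma>) =
      (\<lambda>z\<in>Cx. \<lambda>\<gamma>. (\<lambda>z\<in>Cx. f \<alpha> z) z \<gamma> + (\<lambda>z\<in>Cx. \<lambda>\<gamma>. \<Sum>\<alpha>\<in>S. f \<alpha> z \<gamma>) z \<gamma>)"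
    using insert(1,2) by (intro restrict_ext) simp
  also have "\<dots> \<in> I" using insert by (intro I_add) auto
  finally show ?case .
qed

section \<open>Approximation by truncations\<close>

lemma trunc_C: "a \<in> C \<Longrightarrow> trunc n N a \<in> C"
  using weight_map.T_C[OF weight_map_trunc] weight_family_axioms by blast

text \<open>Unlike the constant in \<open>weight_map_trunc\<close>, this bound is uniform in
  \<open>N\<close>, as the joint limit in \<open>trunc_cnv\<close> requires.\<close>

lemma wnorm_trunc_le:
  assumes "a \<in> C" "w \<in> W"
  shows "wnorm n w (trunc n N a) \<le> wnorm n w a"
proof (rule wnorm_leI[OF _ assms(2)])
  show "trunc n N a \<in> C" by (rule trunc_C[OF assms(1)])
  fix S assume S: "finite S" "S \<subseteq> words n"
  have "(\<Sum>\<alpha>\<in>S. cmod (trunc n N a \<alpha>) * w \<alpha>) \<le> (\<Sum>\<alpha>\<in>S. cmod (a \<alpha>) * w \<alpha>)"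
    using W_nonneg[OF assms(2)] by (intro sum_mono) (simp add: trunc_apply)
  then show "(\<Sum>\<alpha>\<in>S. cmod (trunc n N a \<alpha>) * w \<alpha>) \<le> wnorm n w a"
    using sum_le_wnorm[OF assms S] by linarith
qed

text \<open>The short words exhaust all words by finite sets, so the partial sums over them tend to
  the norm; the truncation error is the remaining tail.\<close>

lemma trunc_tendsto:
  assumes a: "a \<in> C" and w: "w \<in> W"
  shows "(\<lambda>N. wnorm n w (\<lambda>\<alpha>. trunc n N a \<alpha> - a \<alpha>)) \<longlonglongrightarrow> 0"
proof -
  let ?f = "\<lambda>\<alpha>. cmod (a \<alpha>) * w \<alpha>"
  have "filterlim (short_words n) (finite_subsets_at_top (words n)) sequentially"
    unfolding filterlim_finite_subsets_at_top
  proof (intro allI impI, elim conjE)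
    fix X assume X: "finite X" "X \<subseteq> words n"
    have "\<forall>\<^sub>F N in sequentially. \<forall>\<alpha>\<in>X. length \<alpha> \<le> N"
      using X(1) by (intro eventually_ball_finite) (auto simp: eventually_ge_at_top)
    then show "\<forall>\<^sub>F N in sequentially. finite (short_words n N) \<and> X \<subseteq> short_words n N \<and>
        short_words n N \<subseteq> words n"
      by eventually_elim (use X finite_short_words in \<open>auto simp: short_words_def\<close>)
  qed
  then have "(\<lambda>N. sum ?f (short_words n N)) \<longlonglongrightarrow> wnorm n w a"
    unfolding wnorm_def using infsum_tendsto[OF C_summable[OF a w]] by (rule filterlim_compose[rotated])
  then have lim: "(\<lambda>N. wnorm n w a - sum ?f (short_words n N)) \<longlonglongrightarrow> 0"
    using tendsto_diff[OF tendsto_const[of "wnorm n w a"]] by fastforce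
  have le: "wnorm n w (\<lambda>\<alpha>. trunc n N a \<alpha> - a \<alpha>) \<le> wnorm n w a - sum ?f (short_words n N)" for N
  proof (rule wnorm_leI[OF diff_C[OF trunc_C[OF a] a] w])
    fix S assume S: "finite S" "S \<subseteq> words n"
    have "(\<Sum>\<alpha>\<in>S. cmod (trunc n N a \<alpha> - a \<alpha>) * w \<alpha>) = sum ?f (S - short_words n N)"
      using S(1) by (intro sum.mono_neutral_cong_right) (auto simp: trunc_apply)
    also have "\<dots> = sum ?f (S \<union> short_words n N) - sum ?f (short_words n N)"
      using S(1) finite_short_words[of n N]
        sum.union_disjoint[of "S - short_words n N" "short_words n N" ?f]
      by (simp add: Un_Diff_cancel2 Diff_Int_distrib2 Int_commute)
    also have "\<dots> \<le> wnorm n w a - sum ?f (short_words n N)"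
      using S finite_short_words
      by (intro diff_right_mono sum_le_wnorm[OF a w]) (auto simp: short_words_def)
    finally show "(\<Sum>\<alpha>\<in>S. cmod (trunc n N a \<alpha> - a \<alpha>) * w \<alpha>)
        \<le> wnorm n w a - sum ?f (short_words n N)" .
  qed
  show ?thesis
    by (rule real_tendsto_sandwich[OF _ _ tendsto_const lim])
      (auto intro!: always_eventually wnorm_nonneg w le)
qed

lemma eventually_snd_Cx:
  "z \<in> Cx \<Longrightarrow> \<forall>\<^sub>F t in sequentially \<times>\<^sub>F nhds z. snd t \<in> Cx"
  by (rule eventually_compose_filterlim[OF eventually_Cx filterlim_snd])

text \<open>Truncating f y - f z costs at most its norm, whatever \<open>N\<close> is; what remains
  is the truncation error at the fixed point z.\<close>

lemma trunc_cnv: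
  assumes f: "f \<in> H" and z: "z \<in> Cx"
  shows "cnv (\<lambda>(N, y). trunc n N (f y)) (f z) (sequentially \<times>\<^sub>F nhds z)"
proof (rule cnvI)
  have fz: "f z \<in> C" by (rule hol_C[OF f z])
  then show "f z \<in> C" .
  show "\<forall>\<^sub>F t in sequentially \<times>\<^sub>F nhds z. (case t of (N, y) \<Rightarrow> trunc n N (f y)) \<in> C"
    using eventually_snd_Cx[OF z] by eventually_elim (use hol_C[OF f] trunc_C in auto)
  fix w assume w: "w \<in> W"
  let ?g = "\<lambda>t. wnorm n w (\<lambda>\<alpha>. f (snd t) \<alpha> - f z \<alpha>) +
      wnorm n w (\<lambda>\<alpha>. trunc n (fst t) (f z) \<alpha> - f z \<alpha>)"
  have "(?g \<longlongrightarrow> 0 + 0) (sequentially \<times>\<^sub>F nhds z)"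
    by (intro tendsto_add filterlim_compose[OF trunc_tendsto[OF fz w] filterlim_fst]
        filterlim_compose[OF cnv_tendsto[OF hol_cnv[OF f z] w] filterlim_snd])
  moreover have "\<forall>\<^sub>F t in sequentially \<times>\<^sub>F nhds z.
      wnorm n w (\<lambda>\<alpha>. (case t of (N, y) \<Rightarrow> trunc n N (f y)) \<alpha> - f z \<alpha>) \<le> ?g t"
    using eventually_snd_Cx[OF z]
  proof eventually_elim
    case (elim t)
    obtain N y where t: "t = (N, y)" by (cases t)
    have fy: "f y \<in> C" using elim t hol_C[OF f] by simp
    have eq: "(\<lambda>\<alpha>. trunc n N (f y) \<alpha> - f z \<alpha>) =
        (\<lambda>\<alpha>. trunc n N (\<lambda>\<alpha>. f y \<alpha> - f z \<alpha>) \<alpha> + (trunc n N (f z) \<alpha> - f z \<alpha>))"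
      by (simp add: trunc_apply fun_eq_iff)
    have "wnorm n w (\<lambda>\<alpha>. trunc n N (f y) \<alpha> - f z \<alpha>) \<le>
        wnorm n w (trunc n N (\<lambda>\<alpha>. f y \<alpha> - f z \<alpha>)) + wnorm n w (\<lambda>\<alpha>. trunc n N (f z) \<alpha> - f z \<alpha>)"
      unfolding eq by (intro wnorm_add w trunc_C diff_C fy fz)
    also have "\<dots> \<le> ?g t"
      using wnorm_trunc_le[OF diff_C[OF fy fz] w] t by simp
    finally show ?case using t by simp
  qed
  ultimately show "\<exists>g. (g \<longlongrightarrow> 0) (sequentially \<times>\<^sub>F nhds z) \<and> (\<forall>\<^sub>F t in sequentially \<times>\<^sub>F nhds z.
      wnorm n w (\<lambda>\<alpha>. (case t of (N, y) \<Rightarrow> trunc n N (f y)) \<alpha> - f z \<alpha>) \<le> g t)"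
    by auto
qed

end

section \<open>Passing to normal forms\<close>

lemma push_trunc:
  assumes "Q \<subseteq> words n" "\<And>\<alpha>. \<alpha> \<in> Q \<Longrightarrow> length (g \<alpha>) = length \<alpha>" "short_words n N \<subseteq> Q"
  shows "push Q g (trunc n N a) \<gamma> = (\<Sum>\<alpha>\<in>short_words n N. a \<alpha> * monomial (g \<alpha>) \<gamma>)"
proof -
  have "push Q g (trunc n N a) \<gamma> =
      (\<Sum>\<alpha> | \<alpha> \<in> Q \<and> g \<alpha> = \<gamma>. if \<alpha> \<in> short_words n N then a \<alpha> else 0)"
    by (simp add: push_def[of Q] trunc_apply)
  also have "\<dots> = (\<Sum>\<alpha>\<in>{\<alpha> \<in> Q. g \<alpha> = \<gamma>} \<inter> short_words n N. a \<alpha>)"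
    using finite_fibre[OF assms(1,2)] by (simp add: sum.inter_restrict)
  also have "\<dots> = (\<Sum>\<alpha>\<in>short_words n N. a \<alpha> * monomial (g \<alpha>) \<gamma>)"
    using assms(3) finite_short_words
    by (intro sum.mono_neutral_cong_left) (auto simp: monomial_def)
  finally show ?thesis .
qed

lemma trunc_eq_sum: "trunc n N a \<gamma> = (\<Sum>\<alpha>\<in>short_words n N. a \<alpha> * monomial \<alpha> \<gamma>)"
proof -
  have "(\<Sum>\<alpha>\<in>short_words n N. a \<alpha> * monomial \<alpha> \<gamma>) =
      (\<Sum>\<alpha>\<in>short_words n N. if \<gamma> = \<alpha> then a \<alpha> else 0)"
    by (intro sum.cong) (auto simp: monomial_def)
  then show ?thesis using finite_short_words by (simp add: trunc_apply)
qed

abbreviation normalize :: "nat \<Rightarrow> series \<Rightarrow> series" where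
  "normalize n \<equiv> push (words n) (normal_form n)"

text \<open>The difference is a finite combination, with holomorphic coefficients, of differences of
  words treated by \<open>monomial_cong_I\<close>.\<close>

lemma (in weight_family) normalize_trunc_I:
  assumes "f \<in> H"
  shows "(\<lambda>z\<in>Cx. \<lambda>\<gamma>. normalize n (trunc n N (f z)) \<gamma> - trunc n N (f z) \<gamma>) \<in> I"
proof -
  have "(\<lambda>z\<in>Cx. \<lambda>\<gamma>. \<Sum>\<alpha>\<in>short_words n N. f z \<alpha> * (monomial (normal_form n \<alpha>) \<gamma> - monomial \<alpha> \<gamma>)) \<in> I"
  proof (rule I_sum[OF finite_short_words])
    fix \<alpha> assume "\<alpha> \<in> short_words n N"
    then have \<alpha>: "\<alpha> \<in> words n" by (simp add: short_words_def)
    show "(\<lambda>z\<in>Cx. \<lambda>\<gamma>. f z \<alpha> * (monomial (normal_form n \<alpha>) \<gamma> - monomial \<alpha> \<gamma>)) \<in> I"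
      using normal_form[OF \<alpha>] assms by (intro monomial_cong_I hol_coeff) auto
  qed
  moreover have "(\<Sum>\<alpha>\<in>short_words n N. f z \<alpha> * (monomial (normal_form n \<alpha>) \<gamma> - monomial \<alpha> \<gamma>)) =
      normalize n (trunc n N (f z)) \<gamma> - trunc n N (f z) \<gamma>" for z \<gamma>
    by (subst push_trunc; (subst trunc_eq_sum)?)
      (auto simp: normal_form short_words_def right_diff_distrib sum_subtractf)
  ultimately show ?thesis by simp
qed

text \<open>Passes from truncations to all of \<open>H\<close> by continuity. It is applied in the
  smaller algebra for injectivity and in the larger one for surjectivity.\<close>

lemma (in weight_family) normalize_cong_I:
  assumes "weight_map n W W (normalize n)" "f \<in> H"
  shows "(\<lambda>z\<in>Cx. \<lambda>\<gamma>. normalize n (f z) \<gamma> - f z \<gamma>) \<in> I"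
proof (rule I_limit)
  interpret N: weight_map n W W "normalize n" by fact
  show "(\<lambda>z\<in>Cx. \<lambda>\<gamma>. normalize n (trunc n N (f z)) \<gamma> - trunc n N (f z) \<gamma>) \<in> I" for N
    by (rule normalize_trunc_I[OF assms(2)])
  show "(\<lambda>z\<in>Cx. \<lambda>\<gamma>. normalize n (f z) \<gamma> - f z \<gamma>) \<in> H"
    using hol_diff[OF N.hmap_hol[OF assms(2)] assms(2)] by (simp cong: restrict_cong)
  fix z assume z: "z \<in> Cx"
  let ?G = "sequentially \<times>\<^sub>F nhds z"
  have "cnv (\<lambda>t \<gamma>. normalize n (case t of (N, y) \<Rightarrow> trunc n N (f y)) \<gamma> -
      (case t of (N, y) \<Rightarrow> trunc n N (f y)) \<gamma>) (\<lambda>\<gamma>. normalize n (f z) \<gamma> - f z \<gamma>) ?G"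
    by (intro cnv_diff N.cnv_map trunc_cnv assms z)
  moreover have "\<forall>\<^sub>F t in ?G. (\<lambda>\<gamma>. normalize n (case t of (N, y) \<Rightarrow> trunc n N (f y)) \<gamma> -
      (case t of (N, y) \<Rightarrow> trunc n N (f y)) \<gamma>) =
      (case t of (N, y) \<Rightarrow> (\<lambda>z\<in>Cx. \<lambda>\<gamma>. normalize n (trunc n N (f z)) \<gamma> - trunc n N (f z) \<gamma>) y)"
    using eventually_snd_Cx[OF z] by eventually_elim auto
  ultimately have "cnv (\<lambda>(N, y). (\<lambda>z\<in>Cx. \<lambda>\<gamma>. normalize n (trunc n N (f z)) \<gamma> - trunc n N (f z) \<gamma>) y)
      (\<lambda>\<gamma>. normalize n (f z) \<gamma> - f z \<gamma>) ?G"
    by (rule cnv_cong[rotated])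
  then show "cnv (\<lambda>(N, y). (\<lambda>z\<in>Cx. \<lambda>\<gamma>. normalize n (trunc n N (f z)) \<gamma> - trunc n N (f z) \<gamma>) y)
      ((\<lambda>z\<in>Cx. \<lambda>\<gamma>. normalize n (f z) \<gamma> - f z \<gamma>) z) ?G"
    using z by simp
qed

text \<open>\<open>W\<close> belongs to the smaller algebra and \<open>V\<close> to the larger one.
  \<open>V_le_W\<close> expresses the inclusion, \<open>W_normal_le_V\<close> the continuity of
  normal forms in the opposite direction.\<close>

locale normalizing = D: weight_family n W + T: weight_family n V
  for n :: nat and W V :: "(nat list \<Rightarrow> real) set" +
  assumes V_le_W: "v \<in> V \<Longrightarrow> \<exists>w\<in>W. \<exists>c. \<forall>\<alpha>\<in>words n. v \<alpha> \<le> c * w \<alpha>"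
    and W_normal_le_V: "w \<in> W \<Longrightarrow> \<exists>v\<in>V. \<exists>c. \<forall>\<alpha>\<in>words n. w (normal_form n \<alpha>) \<le> c * v \<alpha>"
begin

text \<open>Comparing at the empty word forces the constant to be positive, so that two estimates
  can be chained.\<close>

lemma V_le_W_pos:
  assumes "v \<in> V"
  shows "\<exists>w\<in>W. \<exists>c\<ge>0. \<forall>\<alpha>\<in>words n. v \<alpha> \<le> c * w \<alpha>"
proof -
  obtain w c where wc: "w \<in> W" "\<And>\<alpha>. \<alpha> \<in> words n \<Longrightarrow> v \<alpha> \<le> c * w \<alpha>"
    using V_le_W[OF assms] by blast
  have "0 < c * w []" using wc(2)[of "[]"] T.W_pos[OF assms, of "[]"] by simp
  then have "c \<ge> 0" using D.W_pos[OF wc(1), of "[]"] by (simp add: zero_less_mult_iff)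
  then show ?thesis using wc by blast
qed

lemma W_normal_le_V_pos:
  assumes "w \<in> W"
  shows "\<exists>v\<in>V. \<exists>c\<ge>0. \<forall>\<alpha>\<in>words n. w (normal_form n \<alpha>) \<le> c * v \<alpha>"
proof -
  obtain v c where vc: "v \<in> V" "\<And>\<alpha>. \<alpha> \<in> words n \<Longrightarrow> w (normal_form n \<alpha>) \<le> c * v \<alpha>"
    using W_normal_le_V[OF assms] by blast
  have "0 < c * v []" using vc(2)[of "[]"] D.W_pos[OF assms, of "normal_form n []"] by simp
  then have "c \<ge> 0" using T.W_pos[OF vc(1), of "[]"] by (simp add: zero_less_mult_iff)
  then show ?thesis using vc by blast
qed

sublocale TD: weight_map n V W "normalize n"
  by (rule weight_map_push[OF T.weight_family_axioms D.weight_family_axioms])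
    (use normal_form W_normal_le_V in auto)

text \<open>Here, and likewise in \<open>TT\<close>, the estimate factors through the weights of the
  other algebra.\<close>

lemma DD: "weight_map n W W (normalize n)"
proof (rule weight_map_push[OF D.weight_family_axioms D.weight_family_axioms])
  fix w assume "w \<in> W"
  then obtain v c where v: "v \<in> V" "c \<ge> 0" "\<And>\<alpha>. \<alpha> \<in> words n \<Longrightarrow> w (normal_form n \<alpha>) \<le> c * v \<alpha>"
    using W_normal_le_V_pos by blast
  obtain u d where u: "u \<in> W" "\<And>\<alpha>. \<alpha> \<in> words n \<Longrightarrow> v \<alpha> \<le> d * u \<alpha>"
    using V_le_W[OF v(1)] by blast
  have "w (normal_form n \<alpha>) \<le> (c * d) * u \<alpha>" if "\<alpha> \<in> words n" for \<alpha>
    using order_trans[OF v(3)[OF that] mult_left_mono[OF u(2)[OF that] v(2)]] by (simp add: mult.assoc)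
  then show "\<exists>u\<in>W. \<exists>c. \<forall>\<alpha>\<in>words n. w (normal_form n \<alpha>) \<le> c * u \<alpha>" using u(1) by blast
qed (auto simp: normal_form)

lemma TT: "weight_map n V V (normalize n)"
proof (rule weight_map_push[OF T.weight_family_axioms T.weight_family_axioms])
  fix v assume "v \<in> V"
  then obtain w c where w: "w \<in> W" "c \<ge> 0" "\<And>\<alpha>. \<alpha> \<in> words n \<Longrightarrow> v \<alpha> \<le> c * w \<alpha>"
    using V_le_W_pos by blast
  obtain u d where u: "u \<in> V" "\<And>\<alpha>. \<alpha> \<in> words n \<Longrightarrow> w (normal_form n \<alpha>) \<le> d * u \<alpha>"
    using W_normal_le_V[OF w(1)] by blast
  have "v (normal_form n \<alpha>) \<le> (c * d) * u \<alpha>" if "\<alpha> \<in> words n" for \<alpha>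
    using order_trans[OF w(3)[OF normal_form(4)[OF that]] mult_left_mono[OF u(2)[OF that] w(2)]]
    by (simp add: mult.assoc)
  then show "\<exists>u\<in>V. \<exists>c. \<forall>\<alpha>\<in>words n. v (normal_form n \<alpha>) \<le> c * u \<alpha>" using u(1) by blast
qed (auto simp: normal_form)

sublocale incl: weight_map n W V "\<lambda>a. a"
proof -
  \<comment> \<open>This map is the identity only on series supported on \<open>words n\<close>; it
    lends its estimates to the true identity map.\<close>
  interpret P: weight_map n W V "push (words n) (\<lambda>\<alpha>. \<alpha>)"
    by (rule weight_map_push[OF D.weight_family_axioms T.weight_family_axioms])
      (use V_le_W in auto)
  have P: "push (words n) (\<lambda>\<alpha>. \<alpha>) a = a" if "a \<in> D.C" for a
  proof
    fix \<gamma>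
    have "{\<alpha> \<in> words n. \<alpha> = \<gamma>} = (if \<gamma> \<in> words n then {\<gamma>} else {})" by auto
    then show "push (words n) (\<lambda>\<alpha>. \<alpha>) a \<gamma> = a \<gamma>"
      using D.C_outside[OF that] by (simp add: push_def)
  qed
  show "weight_map n W V (\<lambda>a. a)"
  proof unfold_locales
    fix a assume "a \<in> D.C"
    then show "a \<in> T.C" using P.T_C P by metis
  next
    fix v assume "v \<in> V"
    then show "\<exists>w\<in>W. \<exists>c. \<forall>a\<in>D.C. wnorm n v a \<le> c * wnorm n w a"
      using P.T_bound P by metis
  qed auto
qed

lemma hmap_id: "f \<in> D.H \<Longrightarrow> hmap (\<lambda>a. a) f = f"
  by (simp add: hmap_def D.hol_restrict)

lemma D_sub_T: "f \<in> D.H \<Longrightarrow> f \<in> T.H"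
  using incl.hmap_hol hmap_id by metis

lemma trunc_hol: "f \<in> T.H \<Longrightarrow> hmap (trunc n N) f \<in> D.H"
  by (rule weight_map.hmap_hol[OF weight_map_trunc[OF T.weight_family_axioms D.weight_family_axioms]])

text \<open>In the smaller algebra both sides are congruent to the product p q, by
  \<open>normalize_cong_I\<close>.\<close>

lemma normalize_mult_D:
  assumes p: "p \<in> D.H" and q: "q \<in> D.H"
  shows "(\<lambda>z\<in>Cx. \<lambda>\<gamma>. normalize n (series_mult (p z) (q z)) \<gamma> -
    series_mult (normalize n (p z)) (normalize n (q z)) \<gamma>) \<in> D.I"
proof -
  interpret N: weight_map n W W "normalize n" by (rule DD)
  note c = D.normalize_cong_I[OF DD]
  have "D.cong_I (\<lambda>z. normalize n (series_mult (p z) (q z))) (\<lambda>z. series_mult (p z) (q z))"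
    using c[OF D.hol_mult[OF p q]] by (simp add: D.cong_I_def cong: restrict_cong)
  moreover have "D.cong_I (\<lambda>z. series_mult (normalize n (p z)) (normalize n (q z)))
      (\<lambda>z. series_mult (p z) (normalize n (q z)))"
    by (rule D.cong_I_cong[OF _ _ D.cong_I_mult_right[OF c[OF p, folded D.cong_I_def] N.hmap_hol[OF q]]])
      simp_all
  moreover have "D.cong_I (\<lambda>z. series_mult (p z) (normalize n (q z))) (\<lambda>z. series_mult (p z) (q z))"
    by (rule D.cong_I_mult_left[OF c[OF q, folded D.cong_I_def] p])
  ultimately have "D.cong_I (\<lambda>z. normalize n (series_mult (p z) (q z)))
      (\<lambda>z. series_mult (normalize n (p z)) (normalize n (q z)))"
    using D.cong_I_trans D.cong_I_sym by blast
  then show ?thesis by (simp add: D.cong_I_def)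
qed

text \<open>For f and g in the larger algebra f g need not lie in the smaller one, so it cannot be
  compared modulo \<open>D.I\<close>. Truncations can, and both sides depend continuously on f and g
  as maps into the smaller algebra.\<close>

lemma normalize_mult:
  assumes f: "f \<in> T.H" and g: "g \<in> T.H"
  shows "(\<lambda>z\<in>Cx. \<lambda>\<gamma>. normalize n (series_mult (f z) (g z)) \<gamma> -
    series_mult (normalize n (f z)) (normalize n (g z)) \<gamma>) \<in> D.I"
proof (rule D.I_limit)
  let ?h = "\<lambda>N z \<gamma>. normalize n (series_mult (trunc n N (f z)) (trunc n N (g z))) \<gamma> -
    series_mult (normalize n (trunc n N (f z))) (normalize n (trunc n N (g z))) \<gamma>"
  show "(\<lambda>z\<in>Cx. ?h N z) \<in> D.I" for N
    using normalize_mult_D[OF trunc_hol[OF f, of N] trunc_hol[OF g, of N]]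
    by (simp cong: restrict_cong)
  show "(\<lambda>z\<in>Cx. \<lambda>\<gamma>. normalize n (series_mult (f z) (g z)) \<gamma> -
    series_mult (normalize n (f z)) (normalize n (g z)) \<gamma>) \<in> D.H"
    using D.hol_diff[OF TD.hmap_hol[OF T.hol_mult[OF f g]]
        D.hol_mult[OF TD.hmap_hol[OF f] TD.hmap_hol[OF g]]]
    by (simp cong: restrict_cong)
  fix z assume z: "z \<in> Cx"
  let ?G = "sequentially \<times>\<^sub>F nhds z"
  let ?f = "\<lambda>(N, y). trunc n N (f y)" and ?g = "\<lambda>(N, y). trunc n N (g y)"
  have "D.cnv (\<lambda>t \<gamma>. normalize n (series_mult (?f t) (?g t)) \<gamma> -
        series_mult (normalize n (?f t)) (normalize n (?g t)) \<gamma>)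
      (\<lambda>\<gamma>. normalize n (series_mult (f z) (g z)) \<gamma> -
        series_mult (normalize n (f z)) (normalize n (g z)) \<gamma>) ?G"
    by (intro D.cnv_diff D.cnv_mult TD.cnv_map T.cnv_mult T.trunc_cnv f g z)
  moreover have "\<forall>\<^sub>F t in ?G. (\<lambda>\<gamma>. normalize n (series_mult (?f t) (?g t)) \<gamma> -
        series_mult (normalize n (?f t)) (normalize n (?g t)) \<gamma>) =
      (case t of (N, y) \<Rightarrow> (\<lambda>z\<in>Cx. ?h N z) y)"
    using D.eventually_snd_Cx[OF z] by eventually_elim auto
  ultimately have "D.cnv (\<lambda>(N, y). (\<lambda>z\<in>Cx. ?h N z) y)
      (\<lambda>\<gamma>. normalize n (series_mult (f z) (g z)) \<gamma> -
        series_mult (normalize n (f z)) (normalize n (g z)) \<gamma>) ?G"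
    by (rule D.cnv_cong[rotated])
  then show "D.cnv (\<lambda>(N, y). (\<lambda>z\<in>Cx. ?h N z) y)
      ((\<lambda>z\<in>Cx. \<lambda>\<gamma>. normalize n (series_mult (f z) (g z)) \<gamma> -
        series_mult (normalize n (f z)) (normalize n (g z)) \<gamma>) z) ?G"
    using z by simp
qed

text \<open>The preimage of \<open>D.I\<close> is closed by continuity, and an ideal because
  \<open>normalize\<close> is multiplicative modulo \<open>D.I\<close>. Hence it contains
  \<open>T.I\<close> once it contains the relators.\<close>

lemma normalize_I: "T.I \<subseteq> {f \<in> T.H. hmap (normalize n) f \<in> D.I}"
proof (rule T.I_least)
  let ?J = "{f \<in> T.H. hmap (normalize n) f \<in> D.I}"
  have add: "normalize n (\<lambda>\<alpha>. a \<alpha> + b \<alpha>) = (\<lambda>\<alpha>. normalize n a \<alpha> + normalize n b \<alpha>)" for a b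
    by (simp add: push_def sum.distrib fun_eq_iff)
  have neg: "normalize n (\<lambda>\<alpha>. - a \<alpha>) = (\<lambda>\<alpha>. - normalize n a \<alpha>)" for a
    by (simp add: push_def sum_negf fun_eq_iff)
  have zero: "normalize n (\<lambda>\<alpha>. 0) = (\<lambda>\<alpha>. 0)"
    by (simp add: push_def fun_eq_iff)
  have mult: "hmap (normalize n) (\<lambda>z\<in>Cx. series_mult (f z) (g z)) \<in> D.I"
    if f: "f \<in> T.H" and g: "g \<in> T.H" and
      fg: "(\<lambda>z\<in>Cx. series_mult (normalize n (f z)) (normalize n (g z))) \<in> D.I" for f g
    using D.I_add[OF normalize_mult[OF f g] fg] by (simp add: hmap_def cong: restrict_cong)
  show "ideal ?J T.A"
  proof (rule T.idealI')
    show "(\<lambda>z\<in>Cx. \<lambda>\<alpha>. 0) \<in> ?J"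
      using T.hol_zero D.I_zero by (simp add: hmap_def zero cong: restrict_cong)
  next
    fix f g assume "f \<in> ?J" "g \<in> ?J"
    then show "(\<lambda>z\<in>Cx. \<lambda>\<alpha>. f z \<alpha> + g z \<alpha>) \<in> ?J"
      using T.hol_add[of f g] D.I_add[of "hmap (normalize n) f" "hmap (normalize n) g"]
      by (simp add: hmap_def add cong: restrict_cong)
  next
    fix f assume "f \<in> ?J"
    then show "(\<lambda>z\<in>Cx. \<lambda>\<alpha>. - f z \<alpha>) \<in> ?J"
      using T.hol_uminus[of f] D.I_uminus[of "hmap (normalize n) f"]
      by (simp add: hmap_def neg cong: restrict_cong)
  next
    fix f g assume "f \<in> ?J" and g: "g \<in> T.H"
    then have f: "f \<in> T.H" "hmap (normalize n) f \<in> D.I" by auto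
    show "(\<lambda>z\<in>Cx. series_mult (g z) (f z)) \<in> ?J"
      using T.hol_mult[OF g f(1)] mult[OF g f(1)] D.I_mult_left[OF f(2) TD.hmap_hol[OF g]]
      by (simp cong: restrict_cong)
    show "(\<lambda>z\<in>Cx. series_mult (f z) (g z)) \<in> ?J"
      using T.hol_mult[OF f(1) g] mult[OF f(1) g] D.I_mult_right[OF f(2) TD.hmap_hol[OF g]]
      by (simp cong: restrict_cong)
  qed auto
  show "closedin (topo T.A) ?J"
    using closedin_continuous_map_preimage[OF TD.continuous_map_hmap D.I_closed] by simp
  \<comment> \<open>The relator already lies in the smaller algebra, where it is congruent to its
    normalization.\<close>
  fix i j :: nat assume ij: "1 \<le> i" "i < j" "j \<le> n"
  have "relator i j \<in> D.H" by (rule D.relator_hol[OF ij])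
  from D.I_add[OF D.normalize_cong_I[OF DD this] D.relator_I[OF ij]]
  have "hmap (normalize n) (relator i j) \<in> D.I"
    by (simp add: hmap_def cong: restrict_cong)
  then show "relator i j \<in> ?J" using T.relator_hol[OF ij] by blast
qed

text \<open>The preimage of \<open>T.I\<close> under the inclusion is a closed ideal with the
  relators; this makes the induced map well defined.\<close>

lemma D_I_sub: "D.I \<subseteq> {f \<in> D.H. f \<in> T.I}"
proof (rule D.I_least)
  let ?J = "{f \<in> D.H. f \<in> T.I}"
  show "ideal ?J D.A"
    by (rule D.idealI')
      (auto intro: D.hol_zero T.I_zero D.hol_add T.I_add D.hol_uminus T.I_uminus
        D.hol_mult T.I_mult_left T.I_mult_right D_sub_T)
  have "{f \<in> topspace (topo D.A). hmap (\<lambda>a. a) f \<in> T.I} = ?J"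
    using hmap_id by auto
  then show "closedin (topo D.A) ?J"
    using closedin_continuous_map_preimage[OF incl.continuous_map_hmap T.I_closed] by metis
qed (auto intro: D.relator_hol T.relator_I)

text \<open>Injectivity: for f in \<open>T.I\<close> the normalization lies in \<open>D.I\<close>,
  and for f in the smaller algebra it is congruent to f modulo \<open>D.I\<close>.\<close>

lemma D_I_eq: "f \<in> D.H \<Longrightarrow> f \<in> T.I \<longleftrightarrow> f \<in> D.I"
proof
  assume f: "f \<in> D.H" "f \<in> T.I"
  then have "hmap (normalize n) f \<in> D.I" using normalize_I by blast
  from D.I_diff[OF this D.normalize_cong_I[OF DD f(1)]]
  have "(\<lambda>z\<in>Cx. f z) \<in> D.I" by (simp cong: restrict_cong)
  then show "f \<in> D.I" using D.hol_restrict[OF f(1)] by simp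
qed (use D_I_sub in blast)

end

section \<open>The induced isomorphism\<close>

context weight_family
begin

abbreviation "coset f \<equiv> I +>\<^bsub>A\<^esub> f"
abbreviation "Q \<equiv> quot_alg A I"

lemma coset_eq_iff:
  assumes "f \<in> H" "g \<in> H"
  shows "coset f = coset g \<longleftrightarrow> (\<lambda>z\<in>Cx. \<lambda>\<alpha>. f z \<alpha> - g z \<alpha>) \<in> I"
  using ring.quotient_eq_iff_same_a_r_cos[OF ring_A I_ideal] assms by (simp add: A_minus)

lemma abelian_subgroup_I: "abelian_subgroup I A"
  by (rule abelian_subgroupI3[OF ideal.axioms(1)[OF I_ideal] ring.is_abelian_group[OF ring_A]])

lemma coset_self: "f \<in> H \<Longrightarrow> f \<in> coset f"
  using abelian_subgroup.a_rcos_self[OF abelian_subgroup_I] by simp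

lemma coset_nonempty: "f \<in> H \<Longrightarrow> coset f \<noteq> {}"
  using coset_self by (metis empty_iff)

lemma coset_memD:
  assumes "f \<in> H" "g \<in> coset f"
  shows "g \<in> H" "coset g = coset f"
proof -
  show "g \<in> H"
    using abelian_subgroup.a_elemrcos_carrier[OF abelian_subgroup_I] assms by simp
  show "coset g = coset f"
    using abelian_subgroup.a_repr_independence'[OF abelian_subgroup_I] assms by simp
qed

lemma carrier_Q: "carrier Q = coset ` H"
  by (auto simp: quot_alg_def FactRing_def A_RCOSETS_def')

lemma mult_Q:
  "f \<in> H \<Longrightarrow> g \<in> H \<Longrightarrow> coset f \<otimes>\<^bsub>Q\<^esub> coset g = coset (\<lambda>z\<in>Cx. series_mult (f z) (g z))"
  using ideal.rcoset_mult_add[OF I_ideal, of f g] by (simp add: quot_alg_def FactRing_def)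

lemma add_Q:
  "f \<in> H \<Longrightarrow> g \<in> H \<Longrightarrow> coset f \<oplus>\<^bsub>Q\<^esub> coset g = coset (\<lambda>z\<in>Cx. \<lambda>\<alpha>. f z \<alpha> + g z \<alpha>)"
  using ideal.a_rcos_sum[OF I_ideal, of f g] by (simp add: quot_alg_def FactRing_def)

lemma one_Q: "\<one>\<^bsub>Q\<^esub> = coset (\<lambda>z\<in>Cx. monomial [])"
  by (simp add: quot_alg_def FactRing_def)

text \<open>The union in \<open>quot_alg\<close> collapses, since all representatives give the same
  coset.\<close>

lemma smult_Q:
  assumes "f \<in> H" "h \<in> hol_Cx"
  shows "h \<odot>\<^bsub>Q\<^esub> coset f = coset (\<lambda>z\<in>Cx. \<lambda>\<alpha>. h z * f z \<alpha>)"
proof -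
  have h: "h holomorphic_on Cx" using assms(2) by (simp add: hol_Cx_def)
  have eq: "coset (\<lambda>z\<in>Cx. \<lambda>\<alpha>. h z * g z \<alpha>) = coset (\<lambda>z\<in>Cx. \<lambda>\<alpha>. h z * f z \<alpha>)" if "g \<in> coset f" for g
  proof -
    have g: "g \<in> H" "coset g = coset f" using coset_memD[OF assms(1) that] by auto
    have "(\<lambda>z\<in>Cx. \<lambda>\<alpha>. g z \<alpha> - f z \<alpha>) \<in> I"
      using g coset_eq_iff[OF g(1) assms(1)] by simp
    from I_scale[OF this h] show ?thesis
      using coset_eq_iff[OF hol_scale[OF h g(1)] hol_scale[OF h assms(1)]]
      by (simp add: right_diff_distrib cong: restrict_cong)
  qed
  have "(\<Union>g\<in>coset f. coset (\<lambda>z\<in>Cx. \<lambda>\<alpha>. h z * g z \<alpha>)) = coset (\<lambda>z\<in>Cx. \<lambda>\<alpha>. h z * f z \<alpha>)"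
    by (rule SUP_eq_const[OF coset_nonempty[OF assms(1)] eq])
  then show ?thesis by (simp add: quot_alg_def)
qed

lemma topo_Q: "topo Q = quot_topology (topo A) coset"
  by (simp add: quot_alg_def)

lemma quotient_map_coset: "quotient_map (topo A) (topo Q) coset"
  unfolding topo_Q by (rule quotient_map_quot_topology)

lemma topspace_Q: "topspace (topo Q) = carrier Q"
  using quotient_imp_surjective_map[OF quotient_map_coset] by (simp add: carrier_Q)

lemma openin_Q: "openin (topo Q) U \<longleftrightarrow> U \<subseteq> carrier Q \<and> openin (topo A) {f \<in> H. coset f \<in> U}"
  by (simp add: topo_Q openin_quot_topology carrier_Q)

end

context normalizing
begin

definition induced :: "(complex \<Rightarrow> series) set \<Rightarrow> (complex \<Rightarrow> series) set" where
  "induced X = (\<Union>f\<in>X. T.coset f)"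

lemma induced_coset:
  assumes "f \<in> D.H"
  shows "induced (D.coset f) = T.coset f"
proof -
  have eq: "T.coset g = T.coset f" if "g \<in> D.coset f" for g
  proof -
    have g: "g \<in> D.H" "D.coset g = D.coset f" using D.coset_memD[OF assms that] by auto
    then have "(\<lambda>z\<in>Cx. \<lambda>\<alpha>. g z \<alpha> - f z \<alpha>) \<in> D.I"
      using D.coset_eq_iff[OF g(1) assms] by simp
    then have "(\<lambda>z\<in>Cx. \<lambda>\<alpha>. g z \<alpha> - f z \<alpha>) \<in> T.I" using D_I_sub by blast
    then show ?thesis using T.coset_eq_iff[OF D_sub_T D_sub_T] g(1) assms by simp
  qed
  show ?thesis
    unfolding induced_def by (rule SUP_eq_const[OF D.coset_nonempty[OF assms] eq])
qed

text \<open>Surjectivity: every coset in the larger quotient has a representative from the smaller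
  algebra.\<close>

lemma coset_normalize:
  assumes "f \<in> T.H"
  shows "hmap (normalize n) f \<in> D.H" "T.coset (hmap (normalize n) f) = T.coset f"
proof -
  show *: "hmap (normalize n) f \<in> D.H" by (rule TD.hmap_hol[OF assms])
  show "T.coset (hmap (normalize n) f) = T.coset f"
    using T.coset_eq_iff[OF D_sub_T[OF *] assms] T.normalize_cong_I[OF TT assms]
    by (simp cong: restrict_cong)
qed

lemma inj_on_induced: "inj_on induced (carrier D.Q)"
proof (rule inj_onI)
  fix X Y assume "X \<in> carrier D.Q" "Y \<in> carrier D.Q" and eq: "induced X = induced Y"
  then obtain f g where f: "f \<in> D.H" "X = D.coset f" and g: "g \<in> D.H" "Y = D.coset g"
    by (auto simp: D.carrier_Q)
  have "(\<lambda>z\<in>Cx. \<lambda>\<alpha>. f z \<alpha> - g z \<alpha>) \<in> T.I"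
    using eq f g induced_coset T.coset_eq_iff[OF D_sub_T D_sub_T] by simp
  then show "X = Y"
    using D_I_eq[OF D.hol_diff[OF f(1) g(1)]] D.coset_eq_iff[OF f(1) g(1)] f g by simp
qed

lemma image_induced: "induced ` carrier D.Q = carrier T.Q"
proof (intro equalityI subsetI)
  fix Y assume "Y \<in> carrier T.Q"
  then obtain f where f: "f \<in> T.H" "Y = T.coset f" by (auto simp: T.carrier_Q)
  then have "Y = induced (D.coset (hmap (normalize n) f))"
    using coset_normalize[OF f(1)] induced_coset by simp
  then show "Y \<in> induced ` carrier D.Q"
    using coset_normalize(1)[OF f(1)] by (auto simp: D.carrier_Q)
qed (auto simp: D.carrier_Q T.carrier_Q induced_coset D_sub_T)

lemma induced_alg_hom: "induced \<in> alg_hom hol_Cx D.Q T.Q"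
  unfolding alg_hom_def
proof (intro CollectI conjI ballI ring_hom_memI)
  fix X assume "X \<in> carrier D.Q"
  then show "induced X \<in> carrier T.Q" using image_induced by blast
next
  fix X Y assume "X \<in> carrier D.Q" "Y \<in> carrier D.Q"
  then obtain f g where f: "f \<in> D.H" "X = D.coset f" and g: "g \<in> D.H" "Y = D.coset g"
    by (auto simp: D.carrier_Q)
  show "induced (X \<otimes>\<^bsub>D.Q\<^esub> Y) = induced X \<otimes>\<^bsub>T.Q\<^esub> induced Y"
    using f g by (simp add: D.mult_Q T.mult_Q induced_coset D.hol_mult D_sub_T)
  show "induced (X \<oplus>\<^bsub>D.Q\<^esub> Y) = induced X \<oplus>\<^bsub>T.Q\<^esub> induced Y"
    using f g by (simp add: D.add_Q T.add_Q induced_coset D.hol_add D_sub_T)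
next
  show "induced \<one>\<^bsub>D.Q\<^esub> = \<one>\<^bsub>T.Q\<^esub>"
    by (simp only: D.one_Q T.one_Q induced_coset[OF D.hol_one])
next
  fix h X assume h: "h \<in> hol_Cx" and "X \<in> carrier D.Q"
  then obtain f where f: "f \<in> D.H" "X = D.coset f" by (auto simp: D.carrier_Q)
  have "h holomorphic_on Cx" using h by (simp add: hol_Cx_def)
  then show "induced (h \<odot>\<^bsub>D.Q\<^esub> X) = h \<odot>\<^bsub>T.Q\<^esub> induced X"
    using f h by (simp add: D.smult_Q T.smult_Q induced_coset D.hol_scale D_sub_T)
qed

lemma continuous_map_induced: "continuous_map (topo D.Q) (topo T.Q) induced"
proof (rule continuous_compose_quotient_map[OF D.quotient_map_coset])
  have "continuous_map (topo D.A) (topo T.Q) (T.coset \<circ> hmap (\<lambda>a. a))"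
    by (rule continuous_map_compose[OF incl.continuous_map_hmap
          quotient_imp_continuous_map[OF T.quotient_map_coset]])
  then show "continuous_map (topo D.A) (topo T.Q) (induced \<circ> D.coset)"
    by (rule continuous_map_eq) (simp add: hmap_id induced_coset)
qed

text \<open>Continuity of the inverse, stated without naming it: pulled back to the larger function
  algebra, the image of U is the preimage under \<open>hmap (normalize n)\<close> of an open
  set.\<close>

lemma open_map_induced: "open_map (topo D.Q) (topo T.Q) induced"
  unfolding open_map_def
proof (intro allI impI)
  fix U assume "openin (topo D.Q) U"
  then have U: "U \<subseteq> carrier D.Q" "openin (topo D.A) {f \<in> D.H. D.coset f \<in> U}"
    by (auto simp: D.openin_Q)
  have "T.coset f \<in> induced ` U \<longleftrightarrow> D.coset (hmap (normalize n) f) \<in> U" if f: "f \<in> T.H" for f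
  proof -
    let ?g = "hmap (normalize n) f"
    have g: "?g \<in> D.H" "T.coset f = induced (D.coset ?g)"
      using coset_normalize[OF f] induced_coset by auto
    then have "D.coset ?g \<in> carrier D.Q" by (auto simp: D.carrier_Q)
    then show ?thesis
      unfolding g(2) using inj_on_image_mem_iff[OF inj_on_induced _ U(1)] by blast
  qed
  then have "{f \<in> T.H. T.coset f \<in> induced ` U} =
      {f \<in> topspace (topo T.A). hmap (normalize n) f \<in> {f \<in> D.H. D.coset f \<in> U}}"
    using coset_normalize(1) by auto
  then have "openin (topo T.A) {f \<in> T.H. T.coset f \<in> induced ` U}"
    using openin_continuous_map_preimage[OF TD.continuous_map_hmap U(2)] by simp
  then show "openin (topo T.Q) (induced ` U)"
    using U(1) image_induced by (auto simp: T.openin_Q)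
qed

lemma induced_top_alg_iso: "induced \<in> top_alg_iso hol_Cx D.Q T.Q"
  unfolding top_alg_iso_def
proof (intro CollectI conjI induced_alg_hom)
  show "bij_betw induced (carrier D.Q) (carrier T.Q)"
    using inj_on_induced image_induced by (simp add: bij_betw_def)
  show "homeomorphic_map (topo D.Q) (topo T.Q) induced"
    using continuous_map_induced open_map_induced image_induced inj_on_induced
    by (intro bijective_open_imp_homeomorphic_map) (auto simp: D.topspace_Q T.topspace_Q)
qed

end

definition free_weights :: "ereal \<Rightarrow> (nat list \<Rightarrow> real) set" where
  "free_weights r = {(\<lambda>\<alpha>. \<rho> ^ length \<alpha> * \<tau> powi (sw \<alpha> + 1)) | \<rho> \<tau>. 0 < \<rho> \<and> ereal \<rho> < r \<and> 1 \<le> \<tau>}"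

definition taylor_weights :: "ereal \<Rightarrow> (nat list \<Rightarrow> real) set" where
  "taylor_weights r = {(\<lambda>\<alpha>. \<rho> ^ length \<alpha>) | \<rho>. 0 < \<rho> \<and> ereal \<rho> < r}"

lemma powi_sw: "\<tau> powi (sw \<alpha> + 1) = (\<tau>::real) ^ length (remdups_adj \<alpha>)"
  by (simp only: sw_eq power_int_of_nat)

lemma exists_radius:
  assumes "0 < (r::ereal)"
  shows "\<exists>\<rho>>0. ereal \<rho> < r"
  using ereal_dense2[OF assms] by (metis ereal_less(2))

lemma normalizing_disk:
  assumes "0 < r"
  shows "normalizing n (free_weights r) (taylor_weights r)"
proof unfold_locales
  show "free_weights r \<noteq> {}" "taylor_weights r \<noteq> {}"
    using exists_radius[OF assms] by (auto simp: free_weights_def taylor_weights_def)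
  fix w \<alpha> \<beta> assume "w \<in> free_weights r"
  then obtain \<rho> \<tau> where w: "w = (\<lambda>\<alpha>. \<rho> ^ length \<alpha> * \<tau> ^ length (remdups_adj \<alpha>))" "0 < \<rho>" "1 \<le> \<tau>"
    by (auto simp: free_weights_def powi_sw)
  show "w \<alpha> > 0" using w by simp
  have "\<tau> ^ length (remdups_adj (\<alpha> @ \<beta>)) \<le>
      \<tau> ^ length (remdups_adj \<alpha>) * \<tau> ^ length (remdups_adj \<beta>)"
    unfolding power_add[symmetric]
    by (rule power_increasing[OF length_remdups_adj_append_le w(3)])
  then have "\<rho> ^ length (\<alpha> @ \<beta>) * \<tau> ^ length (remdups_adj (\<alpha> @ \<beta>)) \<le>
      \<rho> ^ length (\<alpha> @ \<beta>) * (\<tau> ^ length (remdups_adj \<alpha>) * \<tau> ^ length (remdups_adj \<beta>))"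
    using w(2) by (intro mult_left_mono) auto
  then show "w (\<alpha> @ \<beta>) \<le> w \<alpha> * w \<beta>"
    unfolding w(1) by (simp add: power_add ac_simps)
next
  fix v \<alpha> \<beta> assume "v \<in> taylor_weights r"
  then obtain \<rho> where "v = (\<lambda>\<alpha>. \<rho> ^ length \<alpha>)" "0 < \<rho>"
    by (auto simp: taylor_weights_def)
  then show "v \<alpha> > 0" "v (\<alpha> @ \<beta>) \<le> v \<alpha> * v \<beta>" by (auto simp: power_add)
next
  fix v assume "v \<in> taylor_weights r"
  then obtain \<rho> where v: "v = (\<lambda>\<alpha>. \<rho> ^ length \<alpha>)" "0 < \<rho>" "ereal \<rho> < r"
    by (auto simp: taylor_weights_def)
  \<comment> \<open>The choice tau = 1 makes each norm of the larger algebra one of those of the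
    smaller algebra.\<close>
  have "(\<lambda>\<alpha>. \<rho> ^ length \<alpha> * 1 powi (sw \<alpha> + 1)) \<in> free_weights r"
    unfolding free_weights_def using v by blast
  then have "v \<in> free_weights r" by (simp add: v(1))
  then show "\<exists>w\<in>free_weights r. \<exists>c. \<forall>\<alpha>\<in>words n. v \<alpha> \<le> c * w \<alpha>"
    by (intro bexI[of _ v] exI[of _ 1]) auto
next
  fix w assume "w \<in> free_weights r"
  then obtain \<rho> \<tau> where w: "w = (\<lambda>\<alpha>. \<rho> ^ length \<alpha> * \<tau> ^ length (remdups_adj \<alpha>))"
    "0 < \<rho>" "ereal \<rho> < r" "1 \<le> \<tau>"
    by (auto simp: free_weights_def powi_sw)
  \<comment> \<open>The tau-part of the weight is at most a constant, because tau >= 1 and a normal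
    form has at most \<open>4 * n\<close> blocks.\<close>
  have "w (normal_form n \<alpha>) \<le> \<tau> ^ (4 * n) * \<rho> ^ length \<alpha>" if "\<alpha> \<in> words n" for \<alpha>
    using power_increasing[OF normal_form(3)[OF that] w(4)] w(2) normal_form(5)[OF that]
    by (simp add: w(1) mult.commute)
  moreover have "(\<lambda>\<alpha>. \<rho> ^ length \<alpha>) \<in> taylor_weights r"
    unfolding taylor_weights_def using w by blast
  ultimately show "\<exists>v\<in>taylor_weights r. \<exists>c. \<forall>\<alpha>\<in>words n. w (normal_form n \<alpha>) \<le> c * v \<alpha>"
    by (intro bexI[of _ "\<lambda>\<alpha>. \<rho> ^ length \<alpha>"] exI[of _ "\<tau> ^ (4 * n)"]) auto
qed

theorem theorem5p8:
  fixes n :: nat and r :: ereal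
  assumes "0 < r"
  shows "(\<forall>f\<in>carrier (hol_alg (F_disk n r)).
            i_DD n r (I_D n r +>\<^bsub>hol_alg (F_disk n r)\<^esub> f) = IT_D n r +>\<^bsub>hol_alg (FT_disk n r)\<^esub> f)
       \<and> i_DD n r \<in> top_alg_iso hol_Cx (O_def n r) (OT_def n r)"
proof -
  interpret normalizing n "free_weights r" "taylor_weights r"
    by (rule normalizing_disk[OF assms])
  have F: "F_disk n r = D.F" "FT_disk n r = T.F"
    by (simp_all add: F_disk_def FT_disk_def free_weights_def taylor_weights_def)
  have I: "I_D n r = D.I" "IT_D n r = T.I"
    by (simp_all only: I_D_def IT_D_def F)
  have i: "i_DD n r = induced"
    by (rule ext) (simp only: i_DD_def induced_def I F)
  show ?thesis
    unfolding O_def_def OT_def_def i I F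
    using induced_coset induced_top_alg_iso by simp
qed

end
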